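(* Let $\varphi$ be an $H$-flow on $M$. Then $$h_{\mathrm{Gur}}^\infty(\varphi)=h_{\mathcal C}^\infty(\varphi).$$
   Context: **Setting.** $(M,g)$ is a complete connected (not necessarily compact) Riemannian manifold with associated distance $d$; $B(x,r)$ is the open ball. **$H$-flow.** An $H$-flow is a $C^1$ flow $(\varphi_t)_{t\in\mathbb R}$ on a complete Riemannian manifold such that: (1) there is a constant $lip(\varphi)$ with $d(\varphi_\tau(x),\varphi_\tau(y))\le lip(\varphi)\,d(x,y)$ for all $x,y\in M$, $\tau\in[-1,1]$; (2) there exist $0<a\le b$ such that for every $x\in M$ there is $\rho>0$ with $a|t|\le d(x,\varphi_t(x))\le b|t|$ for all $t\in[-\rho,\rho]$; (3) (transitivity) for all nonempty open $U,V\subset M$ and every $T>0$ there is $t\ge T$ with $\varphi_t(U)\cap V\ne\emptyset$; (4) (finite exact shadowing) for every compact $K\subset M$, $\delta>0$ and integer $N\ge1$ there is $\eta>0$ such that, for all $x_1,\dots,x_N\in K$ and $t_1,\dots,t_N\ge 0$ with $d(\varphi_{t_i}(x_i),x_{i+1})<\eta$ for $1\le i\le N-1$, there is $y\in M$ with $d(\varphi_{s+\sum_{j=1}^{i-1}t_j}(y),\varphi_s(x_i))<\delta$ for all $1\le i\le N$ and $0\le s\le t_i$; (5) (closing lemma) for every $\epsilon>0$ and $x\in M$ there exist $\delta>0$ and $T_{\min}>0$ such that for every $y\in B(x,\epsilon)$ and $t\ge T_{\min}$ with $d(\varphi_t(y),y)\le\delta$ there exist $z\in B(y,\epsilon)$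 and $\tau\in[t-\epsilon,t+\epsilon]$ with $\varphi_\tau(z)=z$ and $d(\varphi_s(z),\varphi_s(y))\le\epsilon$ for all $0\le s\le t$; (6) (expansivity) for every $\nu>0$ there is $\epsilon>0$ such that, for all $x,y\in M$, if there is a continuous map $s:\mathbb R\to\mathbb R$ with $s(0)=0$ and $d(\varphi_t(x),\varphi_{s(t)}(y))\le\epsilon$ for all $t\in\mathbb R$, then $y=\varphi_\tau(x)$ for some $\tau\in[-\nu,\nu]$. **Gurevic entropy at infinity.** A periodic orbit $\gamma$ is a pair $(\{\varphi_t(x):t\in\mathbb R\},T)$ with $T>0$, $\varphi_T(x)=x$; its period is $\ell(\gamma)=T$ (so multiples of an orbit count as distinct periodic orbits). For a set $A$, $\ell(\gamma\cap A)$ is the Lebesgue measure of $\{t\in[0,\ell(\gamma)]:\varphi_t(x)\in A\}$. For $K\subset M$ compact, $\mathcal P_K(T_0,T_1)$ is the set of periodic orbits $\gamma$ with $\ell(\gamma)\in[T_0,T_1]$ and $\gamma\cap K\neq\emptyset$, and $\mathcal P_K^\alpha(L,L+\sigma)=\{\gamma\in\mathcal P_K(L,L+\sigma):\ell(\gamma\cap K)<\alpha\,\ell(\gamma)\}$. $h_{\mathrm{Gur}}^{K,\alpha}(\varphi)=\limsup_{L\to\infty}\frac1L\log\#\mathcal P_K^\alpha(L,L+\sigma)$ (independent of $\sigma>0$), and $h_{\mathrm{Gur}}^\infty(\varphi)=\inf_K\lim_{\alpha\to0}h_{\mathrm{Gur}}^{K,\alpha}(\varphi)$, the infimum being over compact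 $K$ with nonempty interior. **Chord entropy at infinity.** $B(z,\delta,T)=\{y:d(\varphi_t(z),\varphi_t(y))<\delta\ \forall t\in[0,T]\}$. A set $E$ is $(\delta,T)$-separating if for all distinct $p,q\in E$ there is $t\in[0,T]$ with $d(\varphi_t(p),\varphi_t(q))\ge\delta$. For $K$ compact and $\eta>0$, $K_{-\eta}=K\setminus\bigcup_{x\in\partial K}B(x,\eta)$. For $x,y\in\partial K$ and $0<T^-<T^+$, $\mathcal C^{K^c}(x,y,\eta,T^-,T^+)$ is the set of $z\in B(x,\eta)$ for which there is $\tau\in[T^-,T^+]$ with $\varphi_\tau(z)\in B(y,\eta)$ and $\varphi_{[0,\tau]}(z)\cap K_{-\eta}=\emptyset$. $\mathcal N_{\mathcal C}^{K^c}(x,y,\eta,T^-,T^+,\delta)$ is the maximal cardinality of a $(\delta,T^-)$-separating set $E\subset\mathcal C^{K^c}(x,y,\eta,T^-,T^+)$ such that $\mathcal C^{K^c}(x,y,\eta,T^-,T^+)\subset\bigcup_{z\in E}B(z,\delta,T^-)$. For any $C>0$ (the result does not depend on $C$), $$h_{\mathcal C}^\infty(\varphi)=\inf_K\lim_{\delta\to0}\lim_{\eta\to0}\sup_{x,y\in\partial K}\limsup_{T\to\infty}\frac1T\log\mathcal N_{\mathcal C}^{K^c}(x,y,\eta,T,T+C,\delta),$$ the infimum being over compact $K$ with nonempty interior. *)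

theory Defs
  imports "HOL-Analysis.Analysis"
begin

section \<open>Smooth maps between Euclidean spaces\<close>

text \<open>Only used for open \<open>S\<close> in a Euclidean space, where continuity of all iterated directional
  derivatives up to order \<open>k\<close> is the usual notion of \<open>k\<close> times continuous differentiability.\<close>

fun Ck_on :: "nat \<Rightarrow> 'a::real_normed_vector set \<Rightarrow> ('a \<Rightarrow> 'b::real_normed_vector) \<Rightarrow> bool" where
  "Ck_on 0 S f \<longleftrightarrow> continuous_on S f"
| "Ck_on (Suc k) S f \<longleftrightarrow> (\<forall>x\<in>S. f differentiable (at x)) \<and>
     (\<forall>v. Ck_on k S (\<lambda>x. frechet_derivative f (at x) v))"

definition smooth_on :: "'a::real_normed_vector set \<Rightarrow> ('a \<Rightarrow> 'b::real_normed_vector) \<Rightarrow> bool" where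
  "smooth_on S f \<longleftrightarrow> (\<forall>k. Ck_on k S f)"


section \<open>Complete connected Riemannian manifolds\<close>

text \<open>The manifold is the whole type \<open>'a\<close>, and the Riemannian distance is the distance \<open>dist\<close> of the
  type class (see \<open>dist_eq\<close> below); so \<open>open\<close>, \<open>compact\<close>, \<open>ball\<close>, \<open>frontier\<close>, \<open>interior\<close>
  have their intended meaning. Hausdorffness is automatic, and so is second countability, because
  the manifold is connected and metrizable. A chart is a pair of its domain and its map into the
  model space \<open>'e\<close>, of arbitrary dimension.\<close>

type_synonym ('a, 'e) chart = "'a set \<times> ('a \<Rightarrow> 'e)"

abbreviation chart_inv :: "('a, 'e) chart \<Rightarrow> 'e \<Rightarrow> 'a" where
  "chart_inv c \<equiv> inv_into (fst c) (snd c)"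

locale smooth_manifold =
  fixes A :: "('a::metric_space, 'e::euclidean_space) chart set"
  assumes chart_open: "c \<in> A \<Longrightarrow> open (fst c)"
    and chart_image_open: "c \<in> A \<Longrightarrow> open (snd c ` fst c)"
    and chart_homeo: "c \<in> A \<Longrightarrow> homeomorphism (fst c) (snd c ` fst c) (snd c) (chart_inv c)"
    and charts_cover: "(\<Union>c\<in>A. fst c) = UNIV"
    and charts_compatible:
      "c \<in> A \<Longrightarrow> c' \<in> A \<Longrightarrow> smooth_on (snd c ` (fst c \<inter> fst c')) (snd c' \<circ> chart_inv c)"

text \<open>A Riemannian metric is given by its local expressions: \<open>g c x v w\<close> is the inner product of the
  tangent vectors at \<open>x\<close> whose coordinates in the chart \<open>c\<close> are \<open>v\<close> and \<open>w\<close>.\<close>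

type_synonym ('a, 'e) local_metric = "('a, 'e) chart \<Rightarrow> 'a \<Rightarrow> 'e \<Rightarrow> 'e \<Rightarrow> real"

text \<open>\<open>speed A g \<gamma> t\<close> is the norm of the velocity vector of \<open>\<gamma>\<close> at \<open>t\<close>; by invariance of the metric
  it does not depend on the choice of a chart around \<open>\<gamma> t\<close>.\<close>

definition speed ::
  "('a, 'e::euclidean_space) chart set \<Rightarrow> ('a, 'e) local_metric \<Rightarrow> (real \<Rightarrow> 'a) \<Rightarrow> real \<Rightarrow> real" where
  "speed A g \<gamma> t =
    (let c = (SOME c. c \<in> A \<and> \<gamma> t \<in> fst c); v = vector_derivative (snd c \<circ> \<gamma>) (at t)
     in sqrt (g c (\<gamma> t) v v))"

definition C1_curve_on ::
  "('a::metric_space, 'e::euclidean_space) chart set \<Rightarrow> real set \<Rightarrow> (real \<Rightarrow> 'a) \<Rightarrow> bool" where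
  "C1_curve_on A I \<gamma> \<longleftrightarrow> continuous_on I \<gamma> \<and>
    (\<forall>c\<in>A. \<exists>D. continuous_on {t \<in> I. \<gamma> t \<in> fst c} D \<and>
      (\<forall>t\<in>I. \<gamma> t \<in> fst c \<longrightarrow> ((snd c \<circ> \<gamma>) has_vector_derivative D t) (at t within I)))"

text \<open>The curves are continuously differentiable on each closed piece, with one-sided derivatives at
  the break points; hence their speed is bounded and defined off a finite set, and the integral
  below exists. (The library's \<open>piecewise_C1_differentiable_on\<close> allows unbounded derivatives.)\<close>

definition piecewise_C1_curve ::
  "('a::metric_space, 'e::euclidean_space) chart set \<Rightarrow> (real \<Rightarrow> 'a) \<Rightarrow> bool" where
  "piecewise_C1_curve A \<gamma> \<longleftrightarrow>
    (\<exists>n p. p (0::nat) = 0 \<and> p n = 1 \<and>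
      (\<forall>i<n. p i < p (Suc i) \<and> C1_curve_on A {p i..p (Suc i)} \<gamma>))"

definition curve_length ::
  "('a, 'e::euclidean_space) chart set \<Rightarrow> ('a, 'e) local_metric \<Rightarrow> (real \<Rightarrow> 'a) \<Rightarrow> real" where
  "curve_length A g \<gamma> = integral {0..1} (speed A g \<gamma>)"

definition riemannian_dist ::
  "('a::metric_space, 'e::euclidean_space) chart set \<Rightarrow> ('a, 'e) local_metric \<Rightarrow> 'a \<Rightarrow> 'a \<Rightarrow> real" where
  "riemannian_dist A g x y =
    Inf (curve_length A g ` {\<gamma>. piecewise_C1_curve A \<gamma> \<and> \<gamma> 0 = x \<and> \<gamma> 1 = y})"

locale riemannian_manifold = smooth_manifold A
  for A :: "('a::metric_space, 'e::euclidean_space) chart set" +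
  fixes g :: "('a, 'e) local_metric"
  assumes metric_bilinear: "c \<in> A \<Longrightarrow> x \<in> fst c \<Longrightarrow> bilinear (g c x)"
    and metric_sym: "c \<in> A \<Longrightarrow> x \<in> fst c \<Longrightarrow> g c x v w = g c x w v"
    and metric_pos: "c \<in> A \<Longrightarrow> x \<in> fst c \<Longrightarrow> v \<noteq> 0 \<Longrightarrow> g c x v v > 0"
    and metric_smooth: "c \<in> A \<Longrightarrow> smooth_on (snd c ` fst c) (\<lambda>u. g c (chart_inv c u) v w)"
    and metric_invariant: "c \<in> A \<Longrightarrow> c' \<in> A \<Longrightarrow> x \<in> fst c \<inter> fst c' \<Longrightarrow>
      g c x v w = g c' x (frechet_derivative (snd c' \<circ> chart_inv c) (at (snd c x)) v)
                         (frechet_derivative (snd c' \<circ> chart_inv c) (at (snd c x)) w)"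
    and manifold_connected: "connected (UNIV :: 'a set)"
    and dist_eq: "dist x y = riemannian_dist A g x y"

locale complete_riemannian_manifold = riemannian_manifold A g
  for A :: "('a::metric_space, 'e::euclidean_space) chart set" and g +
  assumes manifold_complete: "complete (UNIV :: 'a set)"


section \<open>H-flows\<close>

definition C1_flow ::
  "('a::metric_space, 'e::euclidean_space) chart set \<Rightarrow> (real \<Rightarrow> 'a \<Rightarrow> 'a) \<Rightarrow> bool" where
  "C1_flow A \<phi> \<longleftrightarrow>
    (\<forall>x. \<phi> 0 x = x) \<and> (\<forall>s t x. \<phi> (s + t) x = \<phi> s (\<phi> t x)) \<and>
    continuous_on UNIV (\<lambda>(t, x). \<phi> t x) \<and>
    (\<forall>c\<in>A. \<forall>c'\<in>A.
      Ck_on 1 {(t, u). u \<in> snd c ` fst c \<and> \<phi> t (chart_inv c u) \<in> fst c'}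
        (\<lambda>(t, u). snd c' (\<phi> t (chart_inv c u))))"

locale H_flow = complete_riemannian_manifold A g
  for A :: "('a::metric_space, 'e::euclidean_space) chart set" and g +
  fixes \<phi> :: "real \<Rightarrow> 'a \<Rightarrow> 'a"
  assumes flow: "C1_flow A \<phi>"
    and lipschitz: "\<exists>L. \<forall>x y. \<forall>\<tau>\<in>{-1..1}. dist (\<phi> \<tau> x) (\<phi> \<tau> y) \<le> L * dist x y"
    and speed_bounds: "\<exists>a b. 0 < a \<and> a \<le> b \<and>
      (\<forall>x. \<exists>\<rho>>0. \<forall>t\<in>{-\<rho>..\<rho>}. a * \<bar>t\<bar> \<le> dist x (\<phi> t x) \<and> dist x (\<phi> t x) \<le> b * \<bar>t\<bar>)"
    and transitivity: "open U \<Longrightarrow> U \<noteq> {} \<Longrightarrow> open V \<Longrightarrow> V \<noteq> {} \<Longrightarrow> T > 0 \<Longrightarrow>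
      \<exists>t\<ge>T. \<phi> t ` U \<inter> V \<noteq> {}"
    and finite_exact_shadowing: "compact K \<Longrightarrow> \<delta> > 0 \<Longrightarrow> N \<ge> 1 \<Longrightarrow>
      \<exists>\<eta>>0. \<forall>(x :: nat \<Rightarrow> 'a) (t :: nat \<Rightarrow> real).
        (\<forall>i\<in>{1..N}. x i \<in> K \<and> t i \<ge> 0) \<and>
        (\<forall>i\<in>{1..<N}. dist (\<phi> (t i) (x i)) (x (i + 1)) < \<eta>) \<longrightarrow>
        (\<exists>y. \<forall>i\<in>{1..N}. \<forall>s\<in>{0..t i}.
          dist (\<phi> (s + (\<Sum>j = 1..<i. t j)) y) (\<phi> s (x i)) < \<delta>)"
    and closing: "\<epsilon> > 0 \<Longrightarrow>
      \<exists>\<delta>>0. \<exists>Tmin>0. \<forall>y\<in>ball x \<epsilon>. \<forall>t\<ge>Tmin. dist (\<phi> t y) y \<le> \<delta> \<longrightarrow>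
        (\<exists>z\<in>ball y \<epsilon>. \<exists>\<tau>\<in>{t - \<epsilon>..t + \<epsilon>}. \<phi> \<tau> z = z \<and>
          (\<forall>s\<in>{0..t}. dist (\<phi> s z) (\<phi> s y) \<le> \<epsilon>))"
    and expansivity: "\<nu> > 0 \<Longrightarrow>
      \<exists>\<epsilon>>0. \<forall>x y. (\<exists>s :: real \<Rightarrow> real. continuous_on UNIV s \<and> s 0 = 0 \<and>
          (\<forall>t. dist (\<phi> t x) (\<phi> (s t) y) \<le> \<epsilon>)) \<longrightarrow>
        (\<exists>\<tau>\<in>{-\<nu>..\<nu>}. y = \<phi> \<tau> x)"


section \<open>Extended cardinalities and logarithms\<close>

text \<open>The cardinality, infinite for infinite sets (where the library's \<open>card\<close> is \<open>0\<close>).\<close>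

definition ecard :: "'b set \<Rightarrow> enat" where
  "ecard S = (if finite S then enat (card S) else \<infinity>)"

text \<open>Natural logarithm with \<open>log 0 = -\<infinity>\<close> and \<open>log \<infinity> = \<infinity>\<close>.\<close>

definition elog :: "enat \<Rightarrow> ereal" where
  "elog n = (case n of enat k \<Rightarrow> if k = 0 then -\<infinity> else ereal (ln (real k)) | \<infinity> \<Rightarrow> \<infinity>)"


section \<open>Gurevic entropy at infinity\<close>

type_synonym 'a periodic_orbit = "'a set \<times> real"

definition periodic_orbits :: "(real \<Rightarrow> 'a \<Rightarrow> 'a) \<Rightarrow> 'a periodic_orbit set" where
  "periodic_orbits \<phi> = {(range (\<lambda>t. \<phi> t x), T) | x T. T > 0 \<and> \<phi> T x = x}"

text \<open>The time spent in \<open>B\<close> does not depend on the base point chosen on the orbit, since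
  \<open>snd \<gamma>\<close> is a period.\<close>

definition time_in :: "(real \<Rightarrow> 'a \<Rightarrow> 'a) \<Rightarrow> 'a periodic_orbit \<Rightarrow> 'a set \<Rightarrow> real" where
  "time_in \<phi> \<gamma> B = measure lebesgue {t \<in> {0..snd \<gamma>}. \<phi> t (SOME x. x \<in> fst \<gamma>) \<in> B}"

definition orbits_meeting ::
  "(real \<Rightarrow> 'a \<Rightarrow> 'a) \<Rightarrow> 'a set \<Rightarrow> real \<Rightarrow> real \<Rightarrow> 'a periodic_orbit set" where
  "orbits_meeting \<phi> K T\<^sub>0 T\<^sub>1 =
    {\<gamma> \<in> periodic_orbits \<phi>. snd \<gamma> \<in> {T\<^sub>0..T\<^sub>1} \<and> fst \<gamma> \<inter> K \<noteq> {}}"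

definition orbits_rarely_in ::
  "(real \<Rightarrow> 'a \<Rightarrow> 'a) \<Rightarrow> 'a set \<Rightarrow> real \<Rightarrow> real \<Rightarrow> real \<Rightarrow> 'a periodic_orbit set" where
  "orbits_rarely_in \<phi> K \<alpha> T\<^sub>0 T\<^sub>1 =
    {\<gamma> \<in> orbits_meeting \<phi> K T\<^sub>0 T\<^sub>1. time_in \<phi> \<gamma> K < \<alpha> * snd \<gamma>}"

definition gurevic_entropy_outside ::
  "real \<Rightarrow> (real \<Rightarrow> 'a \<Rightarrow> 'a) \<Rightarrow> 'a set \<Rightarrow> real \<Rightarrow> ereal" where
  "gurevic_entropy_outside \<sigma> \<phi> K \<alpha> =
    Limsup at_top (\<lambda>L::real. elog (ecard (orbits_rarely_in \<phi> K \<alpha> L (L + \<sigma>))) / ereal L)"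

definition gurevic_entropy_at_infinity ::
  "real \<Rightarrow> (real \<Rightarrow> 'a::metric_space \<Rightarrow> 'a) \<Rightarrow> ereal" where
  "gurevic_entropy_at_infinity \<sigma> \<phi> =
    (INF K\<in>{K. compact K \<and> interior K \<noteq> {}}.
      Lim (at_right 0) (\<lambda>\<alpha>. gurevic_entropy_outside \<sigma> \<phi> K \<alpha>))"


section \<open>Chord entropy at infinity\<close>

definition dyn_ball ::
  "(real \<Rightarrow> 'a::metric_space \<Rightarrow> 'a) \<Rightarrow> 'a \<Rightarrow> real \<Rightarrow> real \<Rightarrow> 'a set" where
  "dyn_ball \<phi> z \<delta> T = {y. \<forall>t\<in>{0..T}. dist (\<phi> t z) (\<phi> t y) < \<delta>}"

definition separating ::
  "(real \<Rightarrow> 'a::metric_space \<Rightarrow> 'a) \<Rightarrow> real \<Rightarrow> real \<Rightarrow> 'a set \<Rightarrow> bool" where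
  "separating \<phi> \<delta> T E \<longleftrightarrow>
    (\<forall>p\<in>E. \<forall>q\<in>E. p \<noteq> q \<longrightarrow> (\<exists>t\<in>{0..T}. dist (\<phi> t p) (\<phi> t q) \<ge> \<delta>))"

definition shrink :: "'a::metric_space set \<Rightarrow> real \<Rightarrow> 'a set" where
  "shrink K \<eta> = K - (\<Union>x\<in>frontier K. ball x \<eta>)"

definition chords ::
  "(real \<Rightarrow> 'a::metric_space \<Rightarrow> 'a) \<Rightarrow> 'a set \<Rightarrow> 'a \<Rightarrow> 'a \<Rightarrow> real \<Rightarrow> real \<Rightarrow> real \<Rightarrow> 'a set" where
  "chords \<phi> K x y \<eta> T\<^sub>0 T\<^sub>1 =
    {z \<in> ball x \<eta>. \<exists>\<tau>\<in>{T\<^sub>0..T\<^sub>1}. \<phi> \<tau> z \<in> ball y \<eta> \<and>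
      (\<lambda>t. \<phi> t z) ` {0..\<tau>} \<inter> shrink K \<eta> = {}}"

definition chord_number ::
  "(real \<Rightarrow> 'a::metric_space \<Rightarrow> 'a) \<Rightarrow> 'a set \<Rightarrow> 'a \<Rightarrow> 'a \<Rightarrow> real \<Rightarrow> real \<Rightarrow> real \<Rightarrow> real \<Rightarrow> enat" where
  "chord_number \<phi> K x y \<eta> T\<^sub>0 T\<^sub>1 \<delta> =
    (SUP E\<in>{E. E \<subseteq> chords \<phi> K x y \<eta> T\<^sub>0 T\<^sub>1 \<and> separating \<phi> \<delta> T\<^sub>0 E \<and>
                chords \<phi> K x y \<eta> T\<^sub>0 T\<^sub>1 \<subseteq> (\<Union>z\<in>E. dyn_ball \<phi> z \<delta> T\<^sub>0)}. ecard E)"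

text \<open>A compact set with empty boundary (the whole manifold, if it is compact) contributes \<open>-\<infinity>\<close>,
  the supremum of the empty set in the extended reals.\<close>

definition chord_entropy_at_infinity ::
  "real \<Rightarrow> (real \<Rightarrow> 'a::metric_space \<Rightarrow> 'a) \<Rightarrow> ereal" where
  "chord_entropy_at_infinity C \<phi> =
    (INF K\<in>{K. compact K \<and> interior K \<noteq> {}}.
      Lim (at_right 0) (\<lambda>\<delta>. Lim (at_right 0) (\<lambda>\<eta>.
        SUP x\<in>frontier K. SUP y\<in>frontier K.
          Limsup at_top (\<lambda>T::real. elog (chord_number \<phi> K x y \<eta> T (T + C) \<delta>) / ereal T))))"

end

theory Submission
  imports Defs
begin

text \<open>
  Both inequalities compare the two infima compact set by compact set.

  From orbits to chords: fix \<open>K\<close>, and let \<open>K'\<close> be the set of points whose orbit visits \<open>K\<close> within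
  time \<open>S\<close>. A periodic orbit decomposes into time steps spent in \<open>K'\<close> and excursions
  from \<open>K\<close> of length at least \<open>S\<close>, and the latter are chords. Each chord begins with time spent in
  \<open>K'\<close>, so an orbit that is rarely in \<open>K'\<close> has few pieces of either kind. Hence
  orbits over a time span \<open>T\<close> during which at most \<open>c\<close> steps lie in \<open>K'\<close> are described, up to a small
  dynamical distance, by \<open>exp (r * T) * Z ^ c\<close> codes, where \<open>r\<close> is any rate above that of the chords
  and \<open>Z\<close> is a constant. By expansivity periodic orbits with the same code coincide.

  From chords to orbits: let \<open>K'\<close> be a compact neighbourhood of \<open>K\<close>. The finite exact
  shadowing property and the closing lemma turn a chord of \<open>K'\<close> into a periodic orbit that follows
  the chord, which is away from \<open>K\<close>, and then passes through \<open>K\<close> and returns in bounded time.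
  Separated chords yield periodic orbits which coincide at most linearly often in the period.
\<close>

section \<open>Limits of monotone functions and logarithms of cardinalities\<close>

text \<open>The order of the quantifiers shapes both directions. For orbits to chords one scale
  \<delta> suffices, a quarter of an expansivity constant, and \<open>K'\<close> may depend on the
  rate through \<open>S\<close>. The obstacle is that the time spent in \<open>K\<close> does not
  bound the number of visits to \<open>K\<close>: an orbit can touch \<open>K\<close> often and
  briefly. Thickening \<open>K\<close> along the flow makes every visit last, so that the number of
  pieces is bounded by a time. The price \<open>Z ^ c\<close> is then harmless: \<open>Z\<close>
  depends neither on \<alpha> nor on the period, and \<open>c\<close> is about
  \<open>\<alpha> * L / \<kappa>\<close>, so the rate grows by
  \<open>\<alpha> * ln Z / \<kappa>\<close>, which vanishes with \<alpha>. For chords to orbits,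
  \<open>K'\<close> has to serve all \<delta>, and \<eta> all pairs of end points. This is possible
  because shadowing is applied to three pieces whatever the length of the chord, and only their
  starting points have to lie in a fixed compact set. The time needed to close up depends on the end
  points but not on the length, so its share of the period tends to 0.\<close>

lemma Lim_at_right_mono:
  fixes f :: "real \<Rightarrow> ereal"
  assumes "\<And>s t. 0 < s \<Longrightarrow> s \<le> t \<Longrightarrow> f s \<le> f t"
  shows "Lim (at_right 0) f = (INF t\<in>{0<..}. f t)"
\<comment> \<open>\<open>Lim\<close> is a definite description, so convergence itself has to be
  proved; monotonicity provides it.\<close>
proof (rule tendsto_Lim)
  show "(f \<longlongrightarrow> (INF t\<in>{0<..}. f t)) (at_right 0)"
  proof (rule decreasing_tendsto)
    show "\<forall>\<^sub>F t in at_right 0. (INF t\<in>{0<..}. f t) \<le> f t"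
      by (auto simp: eventually_at_right_field intro!: exI[of _ 1] INF_lower)
    fix y assume "(INF t\<in>{0<..}. f t) < y"
    then obtain t where t: "0 < t" "f t < y" by (auto simp: INF_less_iff)
    show "\<forall>\<^sub>F s in at_right 0. f s < y"
      unfolding eventually_at_right_field
      using t assms by (intro exI[of _ t]) (auto intro: le_less_trans less_imp_le)
  qed
qed simp

lemma Lim_at_right_antimono:
  fixes f :: "real \<Rightarrow> ereal"
  assumes "\<And>s t. 0 < s \<Longrightarrow> s \<le> t \<Longrightarrow> f t \<le> f s"
  shows "Lim (at_right 0) f = (SUP t\<in>{0<..}. f t)"
proof (rule tendsto_Lim)
  show "(f \<longlongrightarrow> (SUP t\<in>{0<..}. f t)) (at_right 0)"
  proof (rule increasing_tendsto)
    show "\<forall>\<^sub>F t in at_right 0. f t \<le> (SUP t\<in>{0<..}. f t)"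
      by (auto simp: eventually_at_right_field intro!: exI[of _ 1] SUP_upper)
    fix y assume "y < (SUP t\<in>{0<..}. f t)"
    then obtain t where t: "0 < t" "y < f t" by (auto simp: less_SUP_iff)
    show "\<forall>\<^sub>F s in at_right 0. y < f s"
      unfolding eventually_at_right_field
      using t assms by (intro exI[of _ t]) (auto intro: less_le_trans less_imp_le)
  qed
qed simp

lemma ecard_mono: "S \<subseteq> S' \<Longrightarrow> ecard S \<le> ecard S'"
  by (auto simp: ecard_def card_mono finite_subset)

text \<open>The value 0 needs no exception on the right: -\<infinity> lies below \<open>r\<close>
  just as 0 lies below \<open>exp r\<close>.\<close>

lemma elog_le_iff: "elog n \<le> ereal r \<longleftrightarrow> (\<exists>k. n = enat k \<and> real k \<le> exp r)"
proof (cases n)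
  case (enat k)
  then show ?thesis
    by (cases "k = 0") (auto simp: elog_def simp flip: exp_le_cancel_iff[of "ln _"])
qed (simp add: elog_def)

lemma elog_mono: "m \<le> n \<Longrightarrow> elog m \<le> elog n"
  by (cases m; cases n) (auto simp: elog_def)

lemma elog_div_le_iff:
  assumes "T > 0"
  shows "elog n / ereal T \<le> ereal r \<longleftrightarrow> (\<exists>k. n = enat k \<and> real k \<le> exp (r * T))"
proof -
  have "elog n / ereal T \<le> ereal r \<longleftrightarrow> elog n \<le> ereal (r * T)"
    using assms by (simp add: ereal_divide_le_pos mult.commute)
  then show ?thesis by (simp add: elog_le_iff)
qed

lemma elog_div_mono:
  assumes "T > 0" "m \<le> n"
  shows "elog m / ereal T \<le> elog n / ereal T"
  using assms by (intro ereal_divide_right_mono elog_mono) auto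

lemma eventually_le_exp_if_Limsup_less:
  assumes "Limsup at_top (\<lambda>T::real. elog (f T) / ereal T) < ereal r"
  shows "\<forall>\<^sub>F T in at_top. \<exists>k. f T = enat k \<and> real k \<le> exp (r * T)"
  using Limsup_lessD[OF assms] eventually_gt_at_top[of 0]
  by eventually_elim (simp flip: elog_div_le_iff)

text \<open>A subexponential factor \<open>p\<close> is absorbed by an arbitrarily small increase of
  the rate. It is constant when orbits are counted and affine in \<open>T\<close> when chords are
  counted.\<close>

lemma Limsup_elog_le:
  assumes bound: "\<forall>\<^sub>F T in at_top. \<exists>k. f T = enat k \<and> real k \<le> exp (r * T) * p T"
    and subexp: "\<And>s. s > 0 \<Longrightarrow> \<forall>\<^sub>F T in at_top. p T \<le> exp (s * T)"
  shows "Limsup at_top (\<lambda>T::real. elog (f T) / ereal T) \<le> ereal r"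
proof (rule ereal_le_epsilon2)
  fix s :: real assume "s > 0"
  have "\<forall>\<^sub>F T in at_top. elog (f T) / ereal T \<le> ereal (r + s)"
    using bound subexp[OF \<open>s > 0\<close>] eventually_gt_at_top[of 0]
  proof eventually_elim
    case (elim T)
    have "exp (r * T) * p T \<le> exp ((r + s) * T)"
      using elim(2) by (simp add: distrib_right exp_add)
    then show ?case
      unfolding elog_div_le_iff[OF elim(3)] using elim(1) by (meson order.trans)
  qed
  then show "Limsup at_top (\<lambda>T. elog (f T) / ereal T) \<le> ereal r + ereal s"
    using Limsup_bounded by simp
qed


section \<open>Separating sets and chord numbers\<close>

text \<open>A maximal separating set spans, because a point outside all its dynamical balls could be
  added. Maximality comes from Zorn's lemma, as separating sets are not known to be finite
  here.\<close>

lemma separating_extends_to_spanning: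
  assumes "E \<subseteq> S" "separating \<phi> \<delta> T E" "\<delta> > 0"
  obtains D where "E \<subseteq> D" "D \<subseteq> S" "separating \<phi> \<delta> T D" "S \<subseteq> (\<Union>z\<in>D. dyn_ball \<phi> z \<delta> T)"
proof -
  let ?A = "{D. E \<subseteq> D \<and> D \<subseteq> S \<and> separating \<phi> \<delta> T D}"
  have "\<exists>D\<in>?A. \<forall>X\<in>?A. D \<subseteq> X \<longrightarrow> X = D"
  proof (rule subset_Zorn_nonempty)
    show "?A \<noteq> {}" using assms by blast
    fix \<C> assume "\<C> \<noteq> {}" and chain: "subset.chain ?A \<C>"
    then have sub: "\<C> \<subseteq> ?A" and total: "\<And>X Y. X \<in> \<C> \<Longrightarrow> Y \<in> \<C> \<Longrightarrow> X \<subseteq> Y \<or> Y \<subseteq> X"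
      by (auto simp: subset_chain_def)
    have "separating \<phi> \<delta> T (\<Union>\<C>)"
      unfolding separating_def
    proof (intro ballI impI)
      fix p q assume "p \<in> \<Union>\<C>" "q \<in> \<Union>\<C>" "p \<noteq> q"
      then obtain X where "X \<in> \<C>" "p \<in> X" "q \<in> X" using total by blast
      then show "\<exists>t\<in>{0..T}. \<delta> \<le> dist (\<phi> t p) (\<phi> t q)"
        using sub \<open>p \<noteq> q\<close> by (auto simp: separating_def)
    qed
    then show "\<Union>\<C> \<in> ?A" using sub \<open>\<C> \<noteq> {}\<close> by blast
  qed
  then obtain D where "D \<in> ?A" and "\<forall>X\<in>?A. D \<subseteq> X \<longrightarrow> X = D" by (rule bexE)
  then have D: "E \<subseteq> D" "D \<subseteq> S" "separating \<phi> \<delta> T D"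
    and max: "\<And>X. X \<in> ?A \<Longrightarrow> D \<subseteq> X \<Longrightarrow> X = D"
    by simp_all
  have "y \<in> (\<Union>z\<in>D. dyn_ball \<phi> z \<delta> T)" if "y \<in> S" for y
  proof (cases "y \<in> D")
    case True
    moreover have "y \<in> dyn_ball \<phi> y \<delta> T" using \<open>\<delta> > 0\<close> by (simp add: dyn_ball_def)
    ultimately show ?thesis by blast
  next
    case False
    then have "insert y D \<notin> ?A" using max[OF _ subset_insertI] by blast
    moreover have "E \<subseteq> insert y D" "insert y D \<subseteq> S" using D \<open>y \<in> S\<close> by auto
    ultimately have "\<not> separating \<phi> \<delta> T (insert y D)" by simp
    then obtain p q where pq: "p \<in> insert y D" "q \<in> insert y D" "p \<noteq> q"
      and close: "\<forall>t\<in>{0..T}. dist (\<phi> t p) (\<phi> t q) < \<delta>"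
      unfolding separating_def by (meson not_le)
    have "p = y \<or> q = y"
    proof (rule ccontr)
      assume "\<not> (p = y \<or> q = y)"
      then have "p \<in> D" "q \<in> D" using pq by auto
      then obtain t where "t \<in> {0..T}" "\<delta> \<le> dist (\<phi> t p) (\<phi> t q)"
        using D(3) \<open>p \<noteq> q\<close> unfolding separating_def by blast
      then show False using close by force
    qed
    then have "\<exists>z\<in>D. \<forall>t\<in>{0..T}. dist (\<phi> t z) (\<phi> t y) < \<delta>"
    proof
      assume "p = y"
      then show ?thesis using pq close by (intro bexI[of _ q]) (auto simp: dist_commute)
    next
      assume "q = y"
      then show ?thesis using pq close by (intro bexI[of _ p]) auto
    qed
    then show ?thesis by (simp add: dyn_ball_def)
  qed
  then show thesis using D that by blast
qed

text \<open>Each separating set lies in a spanning one with at least as many elements, so the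
  spanning condition does not affect the supremum. Without that condition monotonicity in \<delta>
  and \<eta> becomes visible.\<close>

lemma chord_number_eq:
  assumes "\<delta> > 0"
  shows "chord_number \<phi> K x y \<eta> T\<^sub>0 T\<^sub>1 \<delta> =
    (SUP E\<in>{E. E \<subseteq> chords \<phi> K x y \<eta> T\<^sub>0 T\<^sub>1 \<and> separating \<phi> \<delta> T\<^sub>0 E}. ecard E)"
  unfolding chord_number_def
proof (rule antisym)
  show "(SUP E\<in>{E. E \<subseteq> chords \<phi> K x y \<eta> T\<^sub>0 T\<^sub>1 \<and> separating \<phi> \<delta> T\<^sub>0 E \<and>
      chords \<phi> K x y \<eta> T\<^sub>0 T\<^sub>1 \<subseteq> (\<Union>z\<in>E. dyn_ball \<phi> z \<delta> T\<^sub>0)}. ecard E)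
    \<le> (SUP E\<in>{E. E \<subseteq> chords \<phi> K x y \<eta> T\<^sub>0 T\<^sub>1 \<and> separating \<phi> \<delta> T\<^sub>0 E}. ecard E)"
    by (rule SUP_subset_mono) auto
next
  show "(SUP E\<in>{E. E \<subseteq> chords \<phi> K x y \<eta> T\<^sub>0 T\<^sub>1 \<and> separating \<phi> \<delta> T\<^sub>0 E}. ecard E)
    \<le> (SUP E\<in>{E. E \<subseteq> chords \<phi> K x y \<eta> T\<^sub>0 T\<^sub>1 \<and> separating \<phi> \<delta> T\<^sub>0 E \<and>
      chords \<phi> K x y \<eta> T\<^sub>0 T\<^sub>1 \<subseteq> (\<Union>z\<in>E. dyn_ball \<phi> z \<delta> T\<^sub>0)}. ecard E)"
  proof (rule SUP_mono)
    fix E assume E: "E \<in> {E. E \<subseteq> chords \<phi> K x y \<eta> T\<^sub>0 T\<^sub>1 \<and> separating \<phi> \<delta> T\<^sub>0 E}"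
    then obtain D where "E \<subseteq> D" "D \<subseteq> chords \<phi> K x y \<eta> T\<^sub>0 T\<^sub>1" "separating \<phi> \<delta> T\<^sub>0 D"
      "chords \<phi> K x y \<eta> T\<^sub>0 T\<^sub>1 \<subseteq> (\<Union>z\<in>D. dyn_ball \<phi> z \<delta> T\<^sub>0)"
      using separating_extends_to_spanning[of E _ \<phi> \<delta> T\<^sub>0] assms by blast
    then show "\<exists>D\<in>{E. E \<subseteq> chords \<phi> K x y \<eta> T\<^sub>0 T\<^sub>1 \<and> separating \<phi> \<delta> T\<^sub>0 E \<and>
      chords \<phi> K x y \<eta> T\<^sub>0 T\<^sub>1 \<subseteq> (\<Union>z\<in>E. dyn_ball \<phi> z \<delta> T\<^sub>0)}. ecard E \<le> ecard D"
      using ecard_mono by blast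
  qed
qed

lemma chords_spanning_set:
  assumes "\<delta> > 0" "chord_number \<phi> K x y \<eta> T\<^sub>0 T\<^sub>1 \<delta> = enat k"
  obtains E where "finite E" "card E \<le> k"
    "chords \<phi> K x y \<eta> T\<^sub>0 T\<^sub>1 \<subseteq> (\<Union>z\<in>E. dyn_ball \<phi> z \<delta> T\<^sub>0)"
proof -
  \<comment> \<open>Extending the empty set already yields a spanning set; its size is bounded
    because it is separating too.\<close>
  have "separating \<phi> \<delta> T\<^sub>0 {}" by (simp add: separating_def)
  then obtain E where E: "E \<subseteq> chords \<phi> K x y \<eta> T\<^sub>0 T\<^sub>1" "separating \<phi> \<delta> T\<^sub>0 E"
    "chords \<phi> K x y \<eta> T\<^sub>0 T\<^sub>1 \<subseteq> (\<Union>z\<in>E. dyn_ball \<phi> z \<delta> T\<^sub>0)"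
    by (rule separating_extends_to_spanning[OF empty_subsetI _ assms(1)])
  then have "ecard E \<le> enat k"
    unfolding assms(2)[symmetric] chord_number_eq[OF assms(1)] by (intro SUP_upper) auto
  then have "finite E" "card E \<le> k" by (auto simp: ecard_def split: if_splits)
  then show thesis using E that by blast
qed

text \<open>A larger \<eta> enlarges the balls at both ends and diminishes the set to be avoided, so
  all conditions weaken.\<close>

lemma chords_mono:
  assumes "\<eta> \<le> \<eta>'"
  shows "chords \<phi> K x y \<eta> T\<^sub>0 T\<^sub>1 \<subseteq> chords \<phi> K x y \<eta>' T\<^sub>0 T\<^sub>1"
proof -
  have ball: "ball z \<eta> \<subseteq> ball z \<eta>'" for z :: 'a using assms by auto
  then have shrink: "shrink K \<eta>' \<subseteq> shrink K \<eta>" unfolding shrink_def by blast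
  show ?thesis
  proof
    fix z assume "z \<in> chords \<phi> K x y \<eta> T\<^sub>0 T\<^sub>1"
    then obtain \<tau> where "z \<in> ball x \<eta>" "\<tau> \<in> {T\<^sub>0..T\<^sub>1}" "\<phi> \<tau> z \<in> ball y \<eta>"
      "(\<lambda>t. \<phi> t z) ` {0..\<tau>} \<inter> shrink K \<eta> = {}"
      by (auto simp: chords_def)
    moreover from this have "(\<lambda>t. \<phi> t z) ` {0..\<tau>} \<inter> shrink K \<eta>' = {}"
      using shrink by blast
    ultimately show "z \<in> chords \<phi> K x y \<eta>' T\<^sub>0 T\<^sub>1"
      using ball unfolding chords_def by blast
  qed
qed

section \<open>Iterated limits as infima and suprema\<close>

definition chord_entropy_outside ::
  "real \<Rightarrow> (real \<Rightarrow> 'a::metric_space \<Rightarrow> 'a) \<Rightarrow> 'a set \<Rightarrow> real \<Rightarrow> real \<Rightarrow> ereal" where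
  "chord_entropy_outside C \<phi> K \<delta> \<eta> = (SUP x\<in>frontier K. SUP y\<in>frontier K.
     Limsup at_top (\<lambda>T::real. elog (chord_number \<phi> K x y \<eta> T (T + C) \<delta>) / ereal T))"

lemma chord_number_mono:
  assumes "0 < \<delta>'" "\<delta>' \<le> \<delta>" "\<eta> \<le> \<eta>'"
  shows "chord_number \<phi> K x y \<eta> T\<^sub>0 T\<^sub>1 \<delta> \<le> chord_number \<phi> K x y \<eta>' T\<^sub>0 T\<^sub>1 \<delta>'"
proof -
  have "separating \<phi> \<delta>' T\<^sub>0 E" if "separating \<phi> \<delta> T\<^sub>0 E" for E
    using that assms(2) unfolding separating_def by (metis order.trans)
  moreover have "0 < \<delta>" using assms by simp
  ultimately show ?thesis
    unfolding chord_number_eq[OF \<open>0 < \<delta>\<close>] chord_number_eq[OF assms(1)]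
    using chords_mono[OF assms(3), of \<phi> K x y] by (intro SUP_subset_mono) blast+
qed

lemma chord_entropy_outside_mono:
  assumes "0 < \<delta>'" "\<delta>' \<le> \<delta>" "\<eta> \<le> \<eta>'"
  shows "chord_entropy_outside C \<phi> K \<delta> \<eta> \<le> chord_entropy_outside C \<phi> K \<delta>' \<eta>'"
  unfolding chord_entropy_outside_def
proof (intro SUP_mono bexI)
  fix x y
  show "Limsup at_top (\<lambda>T. elog (chord_number \<phi> K x y \<eta> T (T + C) \<delta>) / ereal T)
    \<le> Limsup at_top (\<lambda>T. elog (chord_number \<phi> K x y \<eta>' T (T + C) \<delta>') / ereal T)"
    by (intro Limsup_mono eventually_mono[OF eventually_gt_at_top[of 0]]
        elog_div_mono chord_number_mono assms)
qed

lemma chord_entropy_at_infinity_eq: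
  "chord_entropy_at_infinity C \<phi> = (INF K\<in>{K. compact K \<and> interior K \<noteq> {}}.
     SUP \<delta>\<in>{0<..}. INF \<eta>\<in>{0<..}. chord_entropy_outside C \<phi> K \<delta> \<eta>)"
proof -
  have "Lim (at_right 0) (\<lambda>\<delta>. Lim (at_right 0) (chord_entropy_outside C \<phi> K \<delta>))
      = (SUP \<delta>\<in>{0<..}. INF \<eta>\<in>{0<..}. chord_entropy_outside C \<phi> K \<delta> \<eta>)" for K
  proof -
    have "Lim (at_right 0) (chord_entropy_outside C \<phi> K \<delta>)
        = (INF \<eta>\<in>{0<..}. chord_entropy_outside C \<phi> K \<delta> \<eta>)" if "\<delta> > 0" for \<delta>
      using that by (intro Lim_at_right_mono chord_entropy_outside_mono) auto
    moreover from this have "Lim (at_right 0) (chord_entropy_outside C \<phi> K t)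
        \<le> Lim (at_right 0) (chord_entropy_outside C \<phi> K s)" if "0 < s" "s \<le> t" for s t
      using that by (auto intro!: INF_mono' chord_entropy_outside_mono)
    ultimately show ?thesis by (subst Lim_at_right_antimono) auto
  qed
  then show ?thesis
    unfolding chord_entropy_at_infinity_def chord_entropy_outside_def[symmetric] by simp
qed

lemma gurevic_entropy_outside_mono:
  assumes "\<alpha> \<le> \<beta>"
  shows "gurevic_entropy_outside \<sigma> \<phi> K \<alpha> \<le> gurevic_entropy_outside \<sigma> \<phi> K \<beta>"
  unfolding gurevic_entropy_outside_def
proof (intro Limsup_mono eventually_mono[OF eventually_gt_at_top[of 0]] elog_div_mono ecard_mono)
  fix L :: real assume "0 < L"
  then have "\<alpha> * T \<le> \<beta> * T" if "L \<le> T" for T using assms that by (simp add: mult_right_mono)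
  then show "orbits_rarely_in \<phi> K \<alpha> L (L + \<sigma>) \<subseteq> orbits_rarely_in \<phi> K \<beta> L (L + \<sigma>)"
    by (auto simp: orbits_rarely_in_def orbits_meeting_def intro: less_le_trans)
qed

lemma gurevic_entropy_at_infinity_eq:
  "gurevic_entropy_at_infinity \<sigma> \<phi> = (INF K\<in>{K. compact K \<and> interior K \<noteq> {}}.
     INF \<alpha>\<in>{0<..}. gurevic_entropy_outside \<sigma> \<phi> K \<alpha>)"
  unfolding gurevic_entropy_at_infinity_def
  by (simp add: Lim_at_right_mono gurevic_entropy_outside_mono)


section \<open>Elementary properties of H-flows\<close>

lemma real_mod_period:
  fixes t T :: real
  assumes "T > 0"
  obtains u k where "0 \<le> u" "u < T" "t = u + of_int k * T"
proof
  show "t = (t - \<lfloor>t / T\<rfloor> * T) + \<lfloor>t / T\<rfloor> * T" by simp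
  show "0 \<le> t - \<lfloor>t / T\<rfloor> * T" using floor_divide_lower[OF assms, of t] by simp
  show "t - \<lfloor>t / T\<rfloor> * T < T"
    using floor_divide_upper[OF assms, of t] by (simp add: algebra_simps)
qed

text \<open>The part of the window beyond \<open>T\<close> translates back to \<open>{0..u}\<close>.
  This frees \<open>time_in\<close> from the arbitrary base point in its definition.\<close>

lemma measure_periodic_set:
  fixes S :: "real set"
  assumes "closed S" and periodic: "\<And>t. t + T \<in> S \<longleftrightarrow> t \<in> S" and u: "0 \<le> u" "u \<le> T"
  shows "measure lebesgue ({u..u + T} \<inter> S) = measure lebesgue ({0..T} \<inter> S)"
proof -
  define m where "m a b = measure lebesgue ({a..b} \<inter> S)" for a b
  have meas: "{a..b} \<inter> S \<in> lmeasurable" for a b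
    using assms(1) by (intro lmeasurable_compact compact_Int_closed) auto
  have split: "m a c = m a b + m b c" if "a \<le> b" "b \<le> c" for a b c
  proof -
    have "negligible (({a..b} \<inter> S) \<inter> ({b..c} \<inter> S))"
      by (rule negligible_subset[of "{b}"]) auto
    moreover have "({a..b} \<inter> S) \<union> ({b..c} \<inter> S) \<union> {} = {a..c} \<inter> S" using that by auto
    ultimately show ?thesis
      unfolding m_def using measure_Un3_negligible[OF meas meas, of "{}"] by simp
  qed
  have "(+) T ` ({0..u} \<inter> S) = {T..T + u} \<inter> S"
    using periodic by (force simp: image_iff algebra_simps intro: bexI[of _ "_ - T"])
  then have shift: "m T (T + u) = m 0 u"
    unfolding m_def by (metis measure_translation)
  have "m u (u + T) = m u T + m T (T + u)" using split[of u T "T + u"] u by (simp add: add.commute)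
  also have "\<dots> = m 0 T" using split[of 0 u T] u shift by simp
  finally show ?thesis by (simp add: m_def)
qed

context H_flow
begin

lemma flow_zero [simp]: "\<phi> 0 x = x"
  using flow by (simp add: C1_flow_def)

lemma flow_add: "\<phi> (s + t) x = \<phi> s (\<phi> t x)"
  using flow by (simp add: C1_flow_def)

lemma flow_minus_cancel [simp]: "\<phi> (- t) (\<phi> t x) = x"
  by (simp flip: flow_add)

lemma continuous_on_flow [continuous_intros]:
  assumes "continuous_on S f" "continuous_on S h"
  shows "continuous_on S (\<lambda>s. \<phi> (f s) (h s))"
proof -
  have "continuous_on UNIV (\<lambda>(t, x). \<phi> t x)" using flow by (simp add: C1_flow_def)
  then have "continuous_on S (\<lambda>s. (\<lambda>(t, x). \<phi> t x) (f s, h s))"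
    by (rule continuous_on_compose2) (auto intro!: continuous_intros assms)
  then show ?thesis by simp
qed

lemma compact_flow_image:
  assumes "compact I" "compact K"
  shows "compact {\<phi> t x | t x. t \<in> I \<and> x \<in> K}"
proof -
  have "{\<phi> t x | t x. t \<in> I \<and> x \<in> K} = (\<lambda>p. \<phi> (fst p) (snd p)) ` (I \<times> K)" by force
  moreover have "compact \<dots>"
    by (intro compact_continuous_image continuous_intros compact_Times assms)
  ultimately show ?thesis by simp
qed

lemma flow_period_multiple:
  assumes "\<phi> T x = x"
  shows "\<phi> (t + of_int k * T) x = \<phi> t x"
proof -
  have nat: "\<phi> (of_nat n * T) x = x" for n
    by (induction n) (simp_all add: distrib_right flow_add assms)
  have "\<phi> (of_int k * T) x = x"
  proof (cases k rule: int_cases2)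
    case (nonneg n)
    then show ?thesis using nat by simp
  next
    case (nonpos n)
    then show ?thesis using flow_minus_cancel[of "of_nat n * T" x] nat by simp
  qed
  then show ?thesis by (simp add: flow_add)
qed

text \<open>The radius of the local bound varies with the point, so the bound is propagated: at the
  last time where it holds, the local bound at the point reached and the triangle inequality carry
  it further with the same slope.\<close>

lemma ex_speed_bound: "\<exists>b>0. \<forall>x t. dist x (\<phi> t x) \<le> b * \<bar>t\<bar>"
proof -
  obtain a b where "0 < a" "a \<le> b" and local:
    "\<And>x. \<exists>\<rho>>0. \<forall>t\<in>{-\<rho>..\<rho>}. a * \<bar>t\<bar> \<le> dist x (\<phi> t x) \<and> dist x (\<phi> t x) \<le> b * \<bar>t\<bar>"
    using speed_bounds by blast
  have forward: "dist x (\<phi> t x) \<le> b * t" if "0 \<le> t" for t x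
  proof -
    define S where "S = {s \<in> {0..t}. dist x (\<phi> s x) \<le> b * s}"
    have "S = {0..t} \<inter> {s. dist x (\<phi> s x) \<le> b * s}" by (auto simp: S_def)
    moreover have "closed {s. dist x (\<phi> s x) \<le> b * s}"
      by (intro closed_Collect_le continuous_intros)
    ultimately have "compact S" by (simp add: compact_Int_closed)
    moreover have "0 \<in> S" using that by (simp add: S_def)
    ultimately obtain m where "m \<in> S" and max: "\<And>s. s \<in> S \<Longrightarrow> s \<le> m"
      using compact_attains_sup[of S] by blast
    then have m: "0 \<le> m" "m \<le> t" "dist x (\<phi> m x) \<le> b * m" by (auto simp: S_def)
    obtain \<rho> where "\<rho> > 0" and \<rho>: "\<And>h. h \<in> {-\<rho>..\<rho>} \<Longrightarrow> dist (\<phi> m x) (\<phi> h (\<phi> m x)) \<le> b * \<bar>h\<bar>"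
      using local[of "\<phi> m x"] by blast
    have "m = t"
    proof (rule ccontr)
      assume "m \<noteq> t"
      define h where "h = min \<rho> (t - m)"
      have h: "0 < h" "h \<le> \<rho>" "m + h \<le> t" using \<open>m \<noteq> t\<close> m \<open>\<rho> > 0\<close> by (auto simp: h_def)
      have "dist x (\<phi> (m + h) x) \<le> dist x (\<phi> m x) + dist (\<phi> m x) (\<phi> h (\<phi> m x))"
        using dist_triangle by (metis add.commute flow_add)
      also have "\<dots> \<le> b * (m + h)" using m(3) \<rho>[of h] h by (simp add: distrib_left)
      finally have "m + h \<in> S" using m h by (simp add: S_def)
      then show False using max h by fastforce
    qed
    then show ?thesis using m by simp
  qed
  have "dist x (\<phi> t x) \<le> b * \<bar>t\<bar>" for x t
  proof (cases "0 \<le> t")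
    case True
    then show ?thesis using forward by simp
  next
    case False
    then show ?thesis using forward[of "- t" "\<phi> t x"] by (simp add: dist_commute)
  qed
  moreover have "b > 0" using \<open>0 < a\<close> \<open>a \<le> b\<close> by simp
  ultimately show ?thesis by blast
qed

lemma ex_moved: "\<exists>t. \<phi> t x \<noteq> x"
proof -
  obtain a b :: real where "0 < a"
    and "\<exists>\<rho>>0. \<forall>t\<in>{-\<rho>..\<rho>}. a * \<bar>t\<bar> \<le> dist x (\<phi> t x) \<and> dist x (\<phi> t x) \<le> b * \<bar>t\<bar>"
    using speed_bounds by blast
  then obtain \<rho> where "\<rho> > 0"
    and \<rho>: "\<And>t. t \<in> {-\<rho>..\<rho>} \<Longrightarrow> a * \<bar>t\<bar> \<le> dist x (\<phi> t x)" by blast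
  have "0 < a * \<bar>\<rho>\<bar>" using \<open>0 < a\<close> \<open>\<rho> > 0\<close> by simp
  also have "\<dots> \<le> dist x (\<phi> \<rho> x)" using \<open>\<rho> > 0\<close> by (intro \<rho>) simp
  finally have "x \<noteq> \<phi> \<rho> x" by auto
  then show ?thesis by metis
qed

lemma time_in_eq:
  assumes "T > 0" "\<phi> T p = p" "closed B"
  shows "time_in \<phi> (range (\<lambda>t. \<phi> t p), T) B = measure lebesgue {t \<in> {0..T}. \<phi> t p \<in> B}"
proof -
  define q where "q = (SOME x. x \<in> range (\<lambda>t. \<phi> t p))"
  have "q \<in> range (\<lambda>t. \<phi> t p)" unfolding q_def by (rule someI) blast
  then obtain t where "q = \<phi> t p" by blast
  then obtain u where u: "0 \<le> u" "u < T" "q = \<phi> u p"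
    using real_mod_period[OF assms(1), of t] flow_period_multiple[OF assms(2)] by metis
  define S where "S = {t. \<phi> t p \<in> B}"
  have "S = (\<lambda>t. \<phi> t p) -` B" by (auto simp: S_def)
  then have "closed S" using assms(3) by (auto intro!: closed_vimage continuous_intros)
  moreover have "t + T \<in> S \<longleftrightarrow> t \<in> S" for t
    using flow_period_multiple[OF assms(2), of t 1] by (simp add: S_def)
  ultimately have "measure lebesgue ({u..u + T} \<inter> S) = measure lebesgue ({0..T} \<inter> S)"
    using u by (intro measure_periodic_set) auto
  moreover have "{u..u + T} \<inter> S = (+) u ` {t \<in> {0..T}. \<phi> t q \<in> B}"
  proof -
    have "\<phi> t q = \<phi> (u + t) p" for t using u(3) by (simp add: flow_add add.commute)
    moreover have "t \<in> (+) u ` R" if "t - u \<in> R" for t R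
      using that by (intro image_eqI[of _ _ "t - u"]) auto
    ultimately show ?thesis by (auto simp: S_def)
  qed
  moreover have "{0..T} \<inter> S = {t \<in> {0..T}. \<phi> t p \<in> B}" by (auto simp: S_def)
  ultimately show ?thesis by (simp add: time_in_def q_def measure_translation)
qed

text \<open>The chart inverse carries a closed ball of the model space to a compact set, which
  contains the open preimage of the open ball.\<close>

lemma compact_neighbourhood_point:
  fixes x :: 'a
  shows "\<exists>C r. compact C \<and> 0 < r \<and> ball x r \<subseteq> C"
proof -
  obtain c where c: "c \<in> A" "x \<in> fst c" using charts_cover by blast
  let ?h = "snd c" and ?k = "chart_inv c"
  have hom: "homeomorphism (fst c) (?h ` fst c) ?h ?k" using chart_homeo c by simp
  obtain e where e: "e > 0" "cball (?h x) e \<subseteq> ?h ` fst c"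
    using chart_image_open[OF c(1)] c(2) open_contains_cball by blast
  have "compact (?k ` cball (?h x) e)"
    using hom e by (intro compact_continuous_image compact_cball)
      (auto simp: homeomorphism_def intro: continuous_on_subset)
  moreover have "open (fst c \<inter> ?h -` ball (?h x) e)"
    using hom chart_open[OF c(1)] by (intro continuous_open_preimage) (auto simp: homeomorphism_def)
  moreover have "x \<in> fst c \<inter> ?h -` ball (?h x) e" using c e by simp
  moreover have "fst c \<inter> ?h -` ball (?h x) e \<subseteq> ?k ` cball (?h x) e"
  proof
    fix z assume z: "z \<in> fst c \<inter> ?h -` ball (?h x) e"
    then have "?k (?h z) = z" using hom by (simp add: homeomorphism_def)
    then show "z \<in> ?k ` cball (?h x) e" using z by (intro image_eqI[of _ _ "?h z"]) auto
  qed
  ultimately show ?thesis by (meson open_contains_ball_eq order.trans)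
qed

text \<open>Halving the radii of a finite subcover leaves room for a radius common to all points of
  \<open>K\<close>, as with a Lebesgue number.\<close>

lemma compact_neighbourhood:
  fixes K :: "'a set"
  assumes "compact K"
  obtains K' \<rho> where "compact K'" "\<rho> > 0" "\<And>x. x \<in> K \<Longrightarrow> ball x \<rho> \<subseteq> K'"
proof -
  obtain C and r :: "'a \<Rightarrow> real" where Cr: "\<And>x. compact (C x)" "\<And>x. 0 < r x" "\<And>x. ball x (r x) \<subseteq> C x"
    using compact_neighbourhood_point by metis
  have "K \<subseteq> (\<Union>x\<in>K. ball x (r x / 2))" using Cr(2) by (force simp: half_gt_zero)
  then obtain F where F: "F \<subseteq> K" "finite F" "K \<subseteq> (\<Union>x\<in>F. ball x (r x / 2))"
    using assms by (rule_tac compactE_image[of K K "\<lambda>x. ball x (r x / 2)"]) auto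
  define \<rho> where "\<rho> = Min (insert 1 ((\<lambda>x. r x / 2) ` F))"
  show thesis
  proof
    show "compact (\<Union>x\<in>F. C x)" using F Cr by (intro compact_UN) auto
    show "\<rho> > 0" using F Cr by (auto simp: \<rho>_def)
    fix x assume "x \<in> K"
    then obtain y where y: "y \<in> F" "dist y x < r y / 2" using F by auto
    then have "\<rho> \<le> r y / 2" unfolding \<rho>_def using F by (intro Min_le) auto
    have "ball x \<rho> \<subseteq> ball y (r y)"
    proof
      fix z assume "z \<in> ball x \<rho>"
      then show "z \<in> ball y (r y)"
        using y(2) \<open>\<rho> \<le> r y / 2\<close> dist_triangle[of y z x] by simp
    qed
    then show "ball x \<rho> \<subseteq> (\<Union>x\<in>F. C x)" using Cr(3)[of y] y by blast
  qed
qed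

end

locale H_flow_speed = H_flow A g \<phi>
  for A :: "('a::metric_space, 'e::euclidean_space) chart set" and g \<phi> +
  fixes b :: real
  assumes speed_pos: "b > 0"
    and dist_flow: "dist x (\<phi> t x) \<le> b * \<bar>t\<bar>"
begin

lemma dist_flow_flow: "dist (\<phi> s x) (\<phi> t x) \<le> b * \<bar>t - s\<bar>"
  using dist_flow[of "\<phi> s x" "t - s"] by (simp flip: flow_add)

text \<open>Every point is displaced at some time, and by a definite amount on a neighbourhood. If
  \<open>T\<close> is a period, that time can be reduced modulo \<open>T\<close>, and a displacement
  reached before \<open>T\<close> is less than \<open>b * T\<close>. Finitely many neighbourhoods
  suffice.\<close>

lemma periods_bounded_below:
  assumes "compact K"
  obtains p where "p > 0" "\<And>x T. x \<in> K \<Longrightarrow> T > 0 \<Longrightarrow> \<phi> T x = x \<Longrightarrow> p \<le> T"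
proof -
  obtain m where m: "\<And>x. \<phi> (m x) x \<noteq> x" using ex_moved by metis
  define e where "e x = dist x (\<phi> (m x) x) / 2" for x
  define U where "U x = {y. e x < dist y (\<phi> (m x) y)}" for x
  have e: "e x > 0" for x using m[of x] by (auto simp: e_def)
  have "open (U x)" for x unfolding U_def by (intro open_Collect_less continuous_intros)
  moreover have "x \<in> U x" for x using e[of x] by (simp add: U_def e_def)
  ultimately obtain F where F: "F \<subseteq> K" "finite F" "K \<subseteq> (\<Union>x\<in>F. U x)"
    using assms by (rule_tac compactE_image[of K K U]) auto
  define p where "p = Min (insert 1 ((\<lambda>x. e x / b) ` F))"
  show thesis
  proof
    show "p > 0" using F e speed_pos by (auto simp: p_def)
    fix x T assume x: "x \<in> K" "T > 0" "\<phi> T x = x"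
    then obtain y where y: "y \<in> F" "x \<in> U y" using F by blast
    obtain u where u: "0 \<le> u" "u < T" "\<phi> (m y) x = \<phi> u x"
      using real_mod_period[OF x(2), of "m y"] flow_period_multiple[OF x(3)] by metis
    have "e y < b * u" using y u dist_flow[of x u] by (simp add: U_def)
    also have "\<dots> \<le> b * T" using u speed_pos by simp
    finally have "e y / b \<le> T" using speed_pos by (simp add: field_simps)
    moreover have "p \<le> e y / b" unfolding p_def using F y by (intro Min_le) auto
    ultimately show "p \<le> T" by simp
  qed
qed

end


section \<open>Covers by sets of small dynamical diameter\<close>

text \<open>Sets of small diameter are used instead of balls, because intersections and preimages
  under the flow need no centre; so \<epsilon> does not grow under concatenation. The half-open time
  interval makes time 0 impose no condition.\<close>

definition coverable ::
  "(real \<Rightarrow> 'a::metric_space \<Rightarrow> 'a) \<Rightarrow> real \<Rightarrow> real \<Rightarrow> 'a set \<Rightarrow> real \<Rightarrow> bool" where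
  "coverable \<phi> \<epsilon> T X R \<longleftrightarrow> (\<exists>P. finite P \<and> real (card P) \<le> R \<and> X \<subseteq> \<Union>P \<and>
    (\<forall>U\<in>P. \<forall>p\<in>U. \<forall>q\<in>U. \<forall>t\<in>{0..<T}. dist (\<phi> t p) (\<phi> t q) \<le> \<epsilon>))"

lemma coverable_subset:
  assumes "coverable \<phi> \<epsilon> T X R" "Y \<subseteq> X" "R \<le> R'"
  shows "coverable \<phi> \<epsilon> T Y R'"
  using assms unfolding coverable_def by (meson order.trans)

lemma coverable_empty: "0 \<le> R \<Longrightarrow> coverable \<phi> \<epsilon> T {} R"
  unfolding coverable_def by (intro exI[of _ "{}"]) simp

lemma coverable_time_0: "1 \<le> R \<Longrightarrow> coverable \<phi> \<epsilon> 0 X R"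
  unfolding coverable_def by (intro exI[of _ "{UNIV}"]) simp

lemma coverable_Un:
  assumes "coverable \<phi> \<epsilon> T X R" "coverable \<phi> \<epsilon> T Y R'"
  shows "coverable \<phi> \<epsilon> T (X \<union> Y) (R + R')"
proof -
  obtain P where P: "finite P" "real (card P) \<le> R" "X \<subseteq> \<Union>P"
    "\<forall>U\<in>P. \<forall>p\<in>U. \<forall>q\<in>U. \<forall>t\<in>{0..<T}. dist (\<phi> t p) (\<phi> t q) \<le> \<epsilon>"
    using assms(1) unfolding coverable_def by (elim exE conjE)
  obtain P' where P': "finite P'" "real (card P') \<le> R'" "Y \<subseteq> \<Union>P'"
    "\<forall>U\<in>P'. \<forall>p\<in>U. \<forall>q\<in>U. \<forall>t\<in>{0..<T}. dist (\<phi> t p) (\<phi> t q) \<le> \<epsilon>"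
    using assms(2) unfolding coverable_def by (elim exE conjE)
  have "real (card (P \<union> P')) \<le> R + R'"
    using P(2) P'(2) card_Un_le[of P P'] by linarith
  moreover have "X \<union> Y \<subseteq> \<Union>(P \<union> P')" using P(3) P'(3) by auto
  ultimately show ?thesis
    unfolding coverable_def using P(1,4) P'(1,4) by (intro exI[of _ "P \<union> P'"] conjI) (simp_all add: ball_Un)
qed

lemma coverable_UN:
  assumes "finite I" "\<And>i. i \<in> I \<Longrightarrow> coverable \<phi> \<epsilon> T (X i) (R i)"
  shows "coverable \<phi> \<epsilon> T (\<Union>i\<in>I. X i) (sum R I)"
  using assms by (induction I) (simp_all add: coverable_empty coverable_Un)

context H_flow
begin

text \<open>Pairing a set for the first stretch with one for the second, pulled back to time 0,
  multiplies the cardinalities.\<close>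

lemma coverable_concat:
  assumes "coverable \<phi> \<epsilon> s X R" "coverable \<phi> \<epsilon> t (\<phi> s ` X) R'" "0 \<le> s"
  shows "coverable \<phi> \<epsilon> (s + t) X (R * R')"
proof -
  obtain P where P: "finite P" "real (card P) \<le> R" "X \<subseteq> \<Union>P"
    "\<forall>U\<in>P. \<forall>p\<in>U. \<forall>q\<in>U. \<forall>t\<in>{0..<s}. dist (\<phi> t p) (\<phi> t q) \<le> \<epsilon>"
    using assms(1) unfolding coverable_def by (elim exE conjE)
  obtain P' where P': "finite P'" "real (card P') \<le> R'" "\<phi> s ` X \<subseteq> \<Union>P'"
    "\<forall>U\<in>P'. \<forall>p\<in>U. \<forall>q\<in>U. \<forall>t\<in>{0..<t}. dist (\<phi> t p) (\<phi> t q) \<le> \<epsilon>"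
    using assms(2) unfolding coverable_def by (elim exE conjE)
  define W where "W = (\<lambda>(U, V). U \<inter> \<phi> s -` V) ` (P \<times> P')"
  have "card W \<le> card P * card P'"
    unfolding W_def card_cartesian_product[symmetric] using P P' by (intro card_image_le) simp
  then have "real (card W) \<le> real (card P) * real (card P')"
    by (metis of_nat_le_iff of_nat_mult)
  also have "\<dots> \<le> R * R'" using P(2) P'(2) by (intro mult_mono) auto
  finally have "real (card W) \<le> R * R'" .
  moreover have "X \<subseteq> \<Union>W"
  proof
    fix x assume "x \<in> X"
    then obtain U V where "U \<in> P" "x \<in> U" "V \<in> P'" "\<phi> s x \<in> V" using P(3) P'(3) by blast
    then show "x \<in> \<Union>W" unfolding W_def by force
  qed
  moreover have "dist (\<phi> u p) (\<phi> u q) \<le> \<epsilon>"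
    if "Y \<in> W" "p \<in> Y" "q \<in> Y" "u \<in> {0..<s + t}" for Y p q u
  proof -
    obtain U V where UV: "U \<in> P" "V \<in> P'" "p \<in> U" "q \<in> U" "\<phi> s p \<in> V" "\<phi> s q \<in> V"
      using \<open>Y \<in> W\<close> \<open>p \<in> Y\<close> \<open>q \<in> Y\<close> unfolding W_def by auto
    show ?thesis
    proof (cases "u < s")
      case True
      then show ?thesis using P(4) UV that(4) by simp
    next
      case False
      then have "dist (\<phi> (u - s) (\<phi> s p)) (\<phi> (u - s) (\<phi> s q)) \<le> \<epsilon>"
        using P'(4) UV that(4) by simp
      then show ?thesis by (simp flip: flow_add)
    qed
  qed
  moreover have "finite W" using P P' by (simp add: W_def)
  ultimately show ?thesis unfolding coverable_def by blast
qed

lemma compact_coverable: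
  assumes "compact X" "\<epsilon> > 0" "T \<le> 1"
  obtains Q where "coverable \<phi> \<epsilon> T X Q"
proof -
  obtain L' where L': "\<And>x y \<tau>. \<tau> \<in> {-1..1} \<Longrightarrow> dist (\<phi> \<tau> x) (\<phi> \<tau> y) \<le> L' * dist x y"
    using lipschitz by blast
  \<comment> \<open>The constant of the Lipschitz condition carries no sign; the maximum makes it
    positive, so that it can be divided by.\<close>
  define L where "L = max 1 L'"
  have "L > 0" by (simp add: L_def)
  have L: "dist (\<phi> \<tau> x) (\<phi> \<tau> y) \<le> L * dist x y" if "\<tau> \<in> {-1..1}" for x y \<tau>
    using L'[OF that, of x y] by (rule order.trans) (simp add: L_def mult_right_mono)
  define r where "r = \<epsilon> / (2 * L)"
  have "r > 0" using assms \<open>L > 0\<close> by (simp add: r_def)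
  then obtain F where F: "finite F" "X \<subseteq> (\<Union>x\<in>F. ball x r)"
    using assms(1) by (auto simp: compact_eq_totally_bounded)
  have "dist (\<phi> t p) (\<phi> t q) \<le> \<epsilon>"
    if "x \<in> F" "p \<in> ball x r" "q \<in> ball x r" "t \<in> {0..<T}" for x p q t
  proof -
    have "dist p q \<le> 2 * r" using that dist_triangle3[of p q x] by simp
    then have "L * dist p q \<le> L * (2 * r)" using \<open>L > 0\<close> by simp
    then show ?thesis using L[of t p q] that assms \<open>L > 0\<close> by (simp add: r_def)
  qed
  then have "coverable \<phi> \<epsilon> T X (real (card ((\<lambda>x. ball x r) ` F)))"
    unfolding coverable_def using F by (intro exI[of _ "(\<lambda>x. ball x r) ` F"]) auto
  then show thesis by (rule that)
qed

end


section \<open>Coding orbits that rarely visit a compact set\<close>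

context H_flow_speed
begin

section \<open>Hull steps and the splitting of an orbit into pieces\<close>

definition flow_hull :: "'a set \<Rightarrow> real \<Rightarrow> 'a set" where
  "flow_hull K S = {\<phi> t x | t x. t \<in> {-S..S} \<and> x \<in> K}"

lemma hullI: "\<phi> v q \<in> K \<Longrightarrow> \<bar>s - v\<bar> \<le> S \<Longrightarrow> \<phi> s q \<in> flow_hull K S"
  unfolding flow_hull_def by (simp, intro exI[of _ "s - v"] exI[of _ "\<phi> v q"]) (auto simp flip: flow_add)

lemma compact_flow_hull: "compact K \<Longrightarrow> compact (flow_hull K S)"
  unfolding flow_hull_def by (rule compact_flow_image) auto

lemma subset_flow_hull: "0 \<le> S \<Longrightarrow> K \<subseteq> flow_hull K S"
  using hullI[of 0 _ K 0] by auto

text \<open>Only steps lying in the hull as a whole count, so that their number times \<kappa>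
  bounds from below a time spent in the hull.\<close>

definition steps_in_hull :: "'a set \<Rightarrow> real \<Rightarrow> real \<Rightarrow> nat \<Rightarrow> 'a \<Rightarrow> nat set" where
  "steps_in_hull K \<kappa> S n q =
    {j. j < n \<and> (\<forall>s\<in>{real j * \<kappa>..(real j + 1) * \<kappa>}. \<phi> s q \<in> flow_hull K S)}"

text \<open>Time is cut into \<open>n\<close> steps of length \<open>\<kappa>\<close>. The first condition says that no long excursion
  away from \<open>K\<close> is in progress at time \<open>0\<close>, except one which starts within one step.\<close>

definition rare_visitors :: "'a set \<Rightarrow> real \<Rightarrow> real \<Rightarrow> nat \<Rightarrow> nat \<Rightarrow> 'a set" where
  "rare_visitors K \<kappa> S n c = {q. (\<exists>v\<in>{-\<kappa>..S}. \<phi> v q \<in> K) \<and>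
     (\<exists>T. (real n - 1) * \<kappa> \<le> T \<and> T < real n * \<kappa> \<and> \<phi> T q \<in> K) \<and>
     card (steps_in_hull K \<kappa> S n q) \<le> c}"

text \<open>The speed bound turns departures from \<open>K\<close> that are close in time into
  points outside \<open>K\<close> that are close in space.\<close>

lemma frontierI_flow:
  assumes "\<phi> w q \<in> K" "\<And>e. e > 0 \<Longrightarrow> \<exists>s. \<bar>s - w\<bar> < e \<and> \<phi> s q \<notin> K"
  shows "\<phi> w q \<in> frontier K"
  unfolding frontier_straddle
proof (safe)
  fix e :: real assume "e > 0"
  then show "\<exists>x\<in>K. dist (\<phi> w q) x < e" using assms(1) by force
  have "e / b > 0" using \<open>e > 0\<close> speed_pos by simp
  then obtain s where s: "\<bar>s - w\<bar> < e / b" "\<phi> s q \<notin> K" using assms(2) by blast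
  then have "b * \<bar>s - w\<bar> < e" using speed_pos by (simp add: field_simps)
  then have "dist (\<phi> w q) (\<phi> s q) < e" using dist_flow_flow[of w q s] by simp
  then show "\<exists>x. x \<notin> K \<and> dist (\<phi> w q) x < e" using s by blast
qed

text \<open>This is the toll paid by every piece of the coding: when the piece is split off, a step
  in the hull goes with it and the budget \<open>c\<close> decreases.\<close>

lemma rare_visitors_first_step:
  assumes q: "q \<in> rare_visitors K \<kappa> S n c" and "n \<ge> 1" "0 < \<kappa>" "2 * \<kappa> \<le> S"
  shows "0 \<in> steps_in_hull K \<kappa> S n q"
proof -
  obtain v where "v \<in> {-\<kappa>..S}" "\<phi> v q \<in> K" using q by (auto simp: rare_visitors_def)
  \<comment> \<open>The offset \<open>s - v\<close> ranges from \<open>- S\<close> to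
    \<open>2 * \<kappa>\<close>, whence the requirement \<open>2 * \<kappa> \<le> S\<close>.\<close>
  then have "\<phi> s q \<in> flow_hull K S" if "s \<in> {0..\<kappa>}" for s
    using that assms by (intro hullI[of v]) auto
  then show ?thesis using assms by (simp add: steps_in_hull_def)
qed

lemma rare_visitors_shift:
  assumes q: "q \<in> rare_visitors K \<kappa> S n c" and n: "1 \<le> l" "l \<le> n" and \<kappa>: "0 < \<kappa>" "2 * \<kappa> \<le> S"
    and visit: "v \<in> {-\<kappa>..S}" "\<phi> v (\<phi> (real l * \<kappa>) q) \<in> K"
  shows "\<phi> (real l * \<kappa>) q \<in> rare_visitors K \<kappa> S (n - l) (c - 1)"
proof -
  let ?q = "\<phi> (real l * \<kappa>) q"
  obtain T where T: "(real n - 1) * \<kappa> \<le> T" "T < real n * \<kappa>" "\<phi> T q \<in> K"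
    and card: "card (steps_in_hull K \<kappa> S n q) \<le> c"
    using q by (auto simp: rare_visitors_def)
  have "(real (n - l) - 1) * \<kappa> \<le> T - real l * \<kappa>" "T - real l * \<kappa> < real (n - l) * \<kappa>"
    "\<phi> (T - real l * \<kappa>) ?q \<in> K"
    using T n by (simp_all add: of_nat_diff algebra_simps flip: flow_add)
  moreover have "card (steps_in_hull K \<kappa> S (n - l) ?q) \<le> c - 1"
  proof -
    \<comment> \<open>Shifting by \<open>l \<ge> 1\<close> embeds the hull steps of the new point
      into those of \<open>q\<close> and misses step 0, which is one of them.\<close>
    have "(\<lambda>j. j + l) ` steps_in_hull K \<kappa> S (n - l) ?q \<subseteq> steps_in_hull K \<kappa> S n q - {0}"
    proof
      fix i assume "i \<in> (\<lambda>j. j + l) ` steps_in_hull K \<kappa> S (n - l) ?q"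
      then obtain j where j: "i = j + l" "j < n - l"
        "\<And>s. s \<in> {real j * \<kappa>..(real j + 1) * \<kappa>} \<Longrightarrow> \<phi> s ?q \<in> flow_hull K S"
        by (auto simp: steps_in_hull_def)
      have "\<phi> s q \<in> flow_hull K S" if "s \<in> {real i * \<kappa>..(real i + 1) * \<kappa>}" for s
        using j(3)[of "s - real l * \<kappa>"] that j(1) by (simp add: algebra_simps flip: flow_add)
      then show "i \<in> steps_in_hull K \<kappa> S n q - {0}"
        using j n by (auto simp: steps_in_hull_def)
    qed
    moreover have "finite (steps_in_hull K \<kappa> S n q)" by (simp add: steps_in_hull_def)
    ultimately have "card ((\<lambda>j. j + l) ` steps_in_hull K \<kappa> S (n - l) ?q)
        \<le> card (steps_in_hull K \<kappa> S n q - {0})" by (intro card_mono) auto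
    also have "\<dots> = card (steps_in_hull K \<kappa> S n q) - 1"
      using rare_visitors_first_step[OF q] n \<kappa> by (intro card_Diff_singleton) auto
    finally show ?thesis using card by (simp add: card_image)
  qed
  ultimately show ?thesis using visit unfolding rare_visitors_def by blast
qed

text \<open>Either the visiting condition renews itself after one step, or \<open>K\<close> is not
  visited from time 0 to \<open>\<kappa> + S\<close>. Then the visit promised near time 0 happened
  before it, and the excursion runs from the last such visit \<open>w\<close> to the first later
  visit \<open>w'\<close>. Both are within one step of the times 0 and \<open>l * \<kappa>\<close>,
  an error in space below \<open>\<eta> / 2\<close>; the other half of \<eta> pays for replacing the
  end points by points of the net.\<close>

lemma rare_visitors_step:
  assumes q: "q \<in> rare_visitors K \<kappa> S n c" and "n \<ge> 1" and \<kappa>: "0 < \<kappa>" "2 * \<kappa> \<le> S"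
    and "closed K" "0 \<le> C" "b * \<kappa> < \<eta> / 2"
    and net: "\<And>x. x \<in> frontier K \<Longrightarrow> \<exists>y\<in>F. dist y x < \<eta> / 2"
  shows "\<phi> \<kappa> q \<in> rare_visitors K \<kappa> S (n - 1) (c - 1) \<or>
    (\<exists>l\<in>{1..n}. \<exists>x\<in>F. \<exists>y\<in>F. S \<le> real l * \<kappa> \<and>
      q \<in> chords \<phi> K x y \<eta> (real l * \<kappa>) (real l * \<kappa> + C) \<and>
      \<phi> (real l * \<kappa>) q \<in> rare_visitors K \<kappa> S (n - l) (c - 1))"
proof (cases "\<exists>v\<in>{-\<kappa>..S}. \<phi> v (\<phi> \<kappa> q) \<in> K")
  case True
  then show ?thesis using rare_visitors_shift[OF q, of 1] \<open>n \<ge> 1\<close> \<kappa> by auto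
next
  case False
  have no_visit: "\<phi> t q \<notin> K" if "t \<in> {0..\<kappa> + S}" for t
    using False that by (auto dest!: bspec[of _ _ "t - \<kappa>"] simp flip: flow_add)
  define V where "V = {t. \<phi> t q \<in> K}"
  have "V = (\<lambda>t. \<phi> t q) -` K" by (auto simp: V_def)
  then have "closed V" using \<open>closed K\<close> by (auto intro!: closed_vimage continuous_intros)
  obtain v T where v: "v \<in> {-\<kappa>..S}" "v \<in> V"
    and T: "(real n - 1) * \<kappa> \<le> T" "T < real n * \<kappa>" "T \<in> V"
    using q by (auto simp: rare_visitors_def V_def)
  have "0 \<le> (real n - 1) * \<kappa>" using \<open>n \<ge> 1\<close> \<kappa> by simp
  then have "T \<ge> 0" using T by linarith
  have "v \<le> 0" using no_visit[of v] v \<kappa> by (force simp: V_def)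
  have "compact ({-\<kappa>..0} \<inter> V)" "{-\<kappa>..0} \<inter> V \<noteq> {}"
    using v \<open>v \<le> 0\<close> \<open>closed V\<close> by (auto intro!: compact_Int_closed)
  then obtain w where w: "w \<in> {-\<kappa>..0} \<inter> V" and last: "\<And>t. t \<in> {-\<kappa>..0} \<inter> V \<Longrightarrow> t \<le> w"
    by (metis compact_attains_sup)
  have "compact ({0..T} \<inter> V)" "{0..T} \<inter> V \<noteq> {}"
    using T \<open>T \<ge> 0\<close> \<open>closed V\<close> by (auto intro!: compact_Int_closed)
  then obtain w' where w': "w' \<in> {0..T} \<inter> V" and first: "\<And>t. t \<in> {0..T} \<inter> V \<Longrightarrow> w' \<le> t"
    by (metis compact_attains_inf)
  have "w' > \<kappa> + S" using no_visit[of w'] w' by (force simp: V_def)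
  have outside: "\<phi> t q \<notin> K" if "w < t" "t < w'" for t
    using last[of t] first[of t] that w w' by (cases "t \<le> 0") (auto simp: V_def)
  have "\<phi> w q \<in> frontier K"
  proof (rule frontierI_flow)
    fix e :: real assume "e > 0"
    then show "\<exists>s. \<bar>s - w\<bar> < e \<and> \<phi> s q \<notin> K"
      using outside[of "w + min (e / 2) ((w' - w) / 2)"] w \<open>w' > \<kappa> + S\<close> \<kappa>
      by (intro exI[of _ "w + min (e / 2) ((w' - w) / 2)"]) (auto simp: min_def field_simps)
  qed (use w in \<open>simp add: V_def\<close>)
  then obtain x where x: "x \<in> F" "dist x (\<phi> w q) < \<eta> / 2" using net by blast
  have w'_frontier: "\<phi> w' q \<in> frontier K"
  proof (rule frontierI_flow)
    fix e :: real assume "e > 0"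
    then show "\<exists>s. \<bar>s - w'\<bar> < e \<and> \<phi> s q \<notin> K"
      using outside[of "w' - min (e / 2) ((w' - w) / 2)"] w \<open>w' > \<kappa> + S\<close> \<kappa>
      by (intro exI[of _ "w' - min (e / 2) ((w' - w) / 2)"]) (auto simp: min_def field_simps)
  qed (use w' in \<open>simp add: V_def\<close>)
  then obtain y where y: "y \<in> F" "dist y (\<phi> w' q) < \<eta> / 2" using net by blast
  \<comment> \<open>The return time is rounded up to a whole number of steps, so that the next piece
    starts on the grid.\<close>
  define l where "l = nat \<lceil>w' / \<kappa>\<rceil>"
  have "w' / \<kappa> > 0" using \<open>w' > \<kappa> + S\<close> \<kappa> by simp
  then have "real l - 1 < w' / \<kappa>" "w' / \<kappa> \<le> real l" unfolding l_def by linarith+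
  then have l: "(real l - 1) * \<kappa> < w'" "w' \<le> real l * \<kappa>" using \<kappa> by (simp_all add: field_simps)
  \<comment> \<open>Between \<open>w'\<close> and the rounded time the orbit may be in
    \<open>K\<close>, but it stays so close to the frontier point reached at \<open>w'\<close> that
    it avoids \<open>shrink K \<eta>\<close>.\<close>
  have near: "dist (\<phi> w' q) (\<phi> t q) < \<eta> / 2" if "w' \<le> t" "t \<le> real l * \<kappa>" for t
  proof -
    have "\<bar>t - w'\<bar> \<le> \<kappa>" using that l by (simp add: algebra_simps)
    then have "b * \<bar>t - w'\<bar> \<le> b * \<kappa>" using speed_pos by simp
    then show ?thesis using dist_flow_flow[of w' q t] \<open>b * \<kappa> < \<eta> / 2\<close> by linarith
  qed
  have "b * \<kappa> > 0" using speed_pos \<kappa> by simp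
  then have "\<eta> > 0" using \<open>b * \<kappa> < \<eta> / 2\<close> by linarith
  have "q \<in> chords \<phi> K x y \<eta> (real l * \<kappa>) (real l * \<kappa> + C)"
    unfolding chords_def
  proof (intro CollectI conjI bexI[of _ "real l * \<kappa>"])
    have "b * \<bar>0 - w\<bar> \<le> b * \<kappa>" using w speed_pos by (intro mult_left_mono) auto
    then have "dist (\<phi> w q) q < \<eta> / 2"
      using dist_flow_flow[of w q 0] \<open>b * \<kappa> < \<eta> / 2\<close> by simp
    then show "q \<in> ball x \<eta>" using x dist_triangle[of x q "\<phi> w q"] by simp
    show "\<phi> (real l * \<kappa>) q \<in> ball y \<eta>"
      using y near[of "real l * \<kappa>"] l dist_triangle[of y "\<phi> (real l * \<kappa>) q" "\<phi> w' q"] by simp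
    have "\<phi> t q \<notin> shrink K \<eta>" if "t \<in> {0..real l * \<kappa>}" for t
    proof (cases "t < w'")
      case True
      have "w < t" using w no_visit[of w] that \<kappa> by (force simp: V_def)
      then show ?thesis using outside True by (simp add: shrink_def)
    next
      case False
      then have "\<phi> t q \<in> ball (\<phi> w' q) \<eta>" using near[of t] that \<open>\<eta> > 0\<close> by simp
      then show ?thesis using w'_frontier by (auto simp: shrink_def)
    qed
    then show "(\<lambda>t. \<phi> t q) ` {0..real l * \<kappa>} \<inter> shrink K \<eta> = {}" by auto
  qed (use \<open>0 \<le> C\<close> in simp)
  moreover have "real l * \<kappa> < (real n + 1) * \<kappa>" using l(1) w' T(2) by (simp add: algebra_simps)
  then have "l < n + 1" using \<kappa> by simp
  moreover have "l \<ge> 1" using \<open>w' / \<kappa> > 0\<close> \<open>w' / \<kappa> \<le> real l\<close> by linarith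
  moreover have "S \<le> real l * \<kappa>" using l \<open>w' > \<kappa> + S\<close> \<kappa> by linarith
  \<comment> \<open>Seen from the new starting point, the visit at \<open>w'\<close> lies at most
    one step in the past. The window in \<open>rare_visitors\<close> begins at
    \<open>- \<kappa>\<close> for this reason.\<close>
  moreover from calculation have "\<phi> (real l * \<kappa>) q \<in> rare_visitors K \<kappa> S (n - l) (c - 1)"
    using w' l \<kappa> by (intro rare_visitors_shift[OF q, where v = "w' - real l * \<kappa>"])
      (auto simp: V_def algebra_simps simp flip: flow_add)
  ultimately show ?thesis using x y by (intro disjI2 bexI[of _ l] bexI[of _ x] bexI[of _ y]) auto
qed

text \<open>Strong induction on \<open>n\<close> splits off the first piece. Measured against the
  target \<open>exp (r' * (real n * \<kappa>))\<close>, a single step costs the factor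
  \<open>Q * exp (- r' * \<kappa>)\<close>, and the chords of \<open>l\<close> steps between net
  points cost the \<open>l\<close>-th power of \<open>exp ((r - r') * \<kappa>)\<close> for each of
  the \<open>(card F)\<^sup>2\<close> pairs. As \<open>r < r'\<close>, the sum over \<open>l\<close>
  converges, and one factor \<open>Z\<close> per unit of \<open>c\<close> pays for all choices of
  the first piece, independently of \<open>n\<close>.\<close>

lemma rare_visitors_coverable:
  assumes \<kappa>: "0 < \<kappa>" "2 * \<kappa> \<le> S" and "closed K" "0 \<le> C" "b * \<kappa> < \<eta> / 2"
    and net: "\<And>x. x \<in> frontier K \<Longrightarrow> \<exists>y\<in>F. dist y x < \<eta> / 2" and "finite F"
    and hull: "coverable \<phi> \<epsilon> \<kappa> (flow_hull K S) Q"
    and chords: "\<And>x y T. x \<in> F \<Longrightarrow> y \<in> F \<Longrightarrow> S \<le> T \<Longrightarrow>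
      coverable \<phi> \<epsilon> T (chords \<phi> K x y \<eta> T (T + C)) (exp (r * T))"
    and "r < r'" and Z: "Q * exp (- r' * \<kappa>) + (real (card F))\<^sup>2 / (1 - exp ((r - r') * \<kappa>)) \<le> Z" "1 \<le> Z"
  shows "coverable \<phi> \<epsilon> (real n * \<kappa>) (rare_visitors K \<kappa> S n c) (exp (r' * (real n * \<kappa>)) * Z ^ c)"
proof (induction n arbitrary: c rule: less_induct)
  case (less n)
  show ?case
  proof (cases "n = 0")
    case True
    then show ?thesis using Z(2) by (simp add: coverable_time_0)
  next
    case n: False
    show ?thesis
    proof (cases c)
      case 0
      \<comment> \<open>A budget of 0 cannot occur for positive \<open>n\<close>, since step 0
        always lies in the hull.\<close>
      have "q \<notin> rare_visitors K \<kappa> S n 0" for q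
      proof
        assume q: "q \<in> rare_visitors K \<kappa> S n 0"
        moreover have "finite (steps_in_hull K \<kappa> S n q)" by (simp add: steps_in_hull_def)
        ultimately have "steps_in_hull K \<kappa> S n q = {}" by (simp add: rare_visitors_def)
        then show False using rare_visitors_first_step[OF q _ \<kappa>] n by simp
      qed
      then have "rare_visitors K \<kappa> S n c = {}" using 0 by auto
      then show ?thesis using Z(2) by (simp add: coverable_empty)
    next
      case (Suc d)
      define w where "w = exp ((r - r') * \<kappa>)"
      have w: "0 < w" "w < 1" using \<open>r < r'\<close> \<kappa> by (auto simp: w_def mult_neg_pos)
      define M where "M = exp (r' * (real n * \<kappa>)) * Z ^ d"
      \<comment> \<open>The condition on the remainder after the first piece; intersecting with it
        lets the induction hypothesis cover what follows that piece.\<close>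
      define X where "X l = {q. \<phi> (real l * \<kappa>) q \<in> rare_visitors K \<kappa> S (n - l) d}" for l
      define I where "I = {l \<in> {1..n}. S \<le> real l * \<kappa>} \<times> F \<times> F"
      define Y where "Y = (\<lambda>(l, x, y). chords \<phi> K x y \<eta> (real l * \<kappa>) (real l * \<kappa> + C) \<inter> X l)"
      have ih: "coverable \<phi> \<epsilon> (real n * \<kappa>) (B \<inter> X l) (R * (exp (r' * (real (n - l) * \<kappa>)) * Z ^ d))"
        if "coverable \<phi> \<epsilon> (real l * \<kappa>) B R" "l \<in> {1..n}" for l B R
      proof -
        have "coverable \<phi> \<epsilon> (real l * \<kappa> + real (n - l) * \<kappa>) (B \<inter> X l)
          (R * (exp (r' * (real (n - l) * \<kappa>)) * Z ^ d))"
          using that n \<kappa> by (intro coverable_concat coverable_subset[OF that(1)]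
            coverable_subset[OF less.IH[of "n - l" d]]) (auto simp: X_def)
        moreover have "real l * \<kappa> + real (n - l) * \<kappa> = real n * \<kappa>"
          using that by (simp add: of_nat_diff algebra_simps)
        ultimately show ?thesis by simp
      qed
      have "rare_visitors K \<kappa> S n c \<subseteq> (flow_hull K S \<inter> X 1) \<union> (\<Union>i\<in>I. Y i)"
      proof
        fix q assume q: "q \<in> rare_visitors K \<kappa> S n c"
        have "\<phi> 0 q \<in> flow_hull K S"
          using rare_visitors_first_step[OF q] n \<kappa> by (force simp: steps_in_hull_def)
        then show "q \<in> (flow_hull K S \<inter> X 1) \<union> (\<Union>i\<in>I. Y i)"
          using rare_visitors_step[OF q _ \<kappa> \<open>closed K\<close> \<open>0 \<le> C\<close> \<open>b * \<kappa> < \<eta> / 2\<close> net] n Suc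
          by (force simp: X_def Y_def I_def)
      qed
      moreover have "coverable \<phi> \<epsilon> (real n * \<kappa>) (flow_hull K S \<inter> X 1) (Q * exp (- r' * \<kappa>) * M)"
      proof -
        have "exp (- r' * \<kappa>) * M = exp (r' * (real (n - 1) * \<kappa>)) * Z ^ d"
          using n by (simp add: M_def of_nat_diff algebra_simps flip: exp_add)
        then show ?thesis using ih[of 1 "flow_hull K S" Q] hull n by (simp add: mult.assoc)
      qed
      moreover have "coverable \<phi> \<epsilon> (real n * \<kappa>) (\<Union>i\<in>I. Y i) (\<Sum>i\<in>I. w ^ fst i * M)"
      proof (rule coverable_UN)
        show "finite I" using \<open>finite F\<close> by (simp add: I_def)
        fix i assume "i \<in> I"
        then obtain l x y where i: "i = (l, x, y)" "l \<in> {1..n}" "S \<le> real l * \<kappa>" "x \<in> F" "y \<in> F"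
          by (auto simp: I_def)
        have "exp (r * (real l * \<kappa>)) * exp (r' * (real (n - l) * \<kappa>)) = w ^ l * exp (r' * (real n * \<kappa>))"
          using i(2) by (simp add: w_def of_nat_diff algebra_simps flip: exp_add exp_of_nat_mult)
        then have "exp (r * (real l * \<kappa>)) * (exp (r' * (real (n - l) * \<kappa>)) * Z ^ d) = w ^ l * M"
          by (simp add: M_def)
        then show "coverable \<phi> \<epsilon> (real n * \<kappa>) (Y i) (w ^ fst i * M)"
          using ih[OF chords[OF i(4,5,3)] i(2)] i(1) by (simp add: Y_def)
      qed
      ultimately have "coverable \<phi> \<epsilon> (real n * \<kappa>) (rare_visitors K \<kappa> S n c)
          (Q * exp (- r' * \<kappa>) * M + (\<Sum>i\<in>I. w ^ fst i * M))"
        by (meson coverable_Un coverable_subset order.refl)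
      moreover have "Q * exp (- r' * \<kappa>) * M + (\<Sum>i\<in>I. w ^ fst i * M) \<le> exp (r' * (real n * \<kappa>)) * Z ^ c"
      proof -
        have "(\<Sum>i\<in>I. w ^ fst i * M) = (\<Sum>l | l \<in> {1..n} \<and> S \<le> real l * \<kappa>. w ^ l) * (real (card F))\<^sup>2 * M"
        proof -
          have "(\<Sum>i\<in>I. w ^ fst i * M) =
              (\<Sum>l | l \<in> {1..n} \<and> S \<le> real l * \<kappa>. \<Sum>z\<in>F \<times> F. w ^ l * M)"
            unfolding I_def sum.cartesian_product by (simp add: case_prod_beta)
          also have "\<dots> = (\<Sum>l | l \<in> {1..n} \<and> S \<le> real l * \<kappa>. w ^ l * (real (card F))\<^sup>2 * M)"
            by (simp add: card_cartesian_product power2_eq_square mult_ac)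
          finally show ?thesis by (simp only: sum_distrib_right)
        qed
        also have "\<dots> \<le> (1 / (1 - w)) * (real (card F))\<^sup>2 * M"
        proof (intro mult_right_mono)
          have "(\<Sum>l | l \<in> {1..n} \<and> S \<le> real l * \<kappa>. w ^ l) \<le> (\<Sum>l. w ^ l)"
            using w by (intro sum_le_suminf summable_geometric) auto
          then show "(\<Sum>l | l \<in> {1..n} \<and> S \<le> real l * \<kappa>. w ^ l) \<le> 1 / (1 - w)"
            using w by (simp add: suminf_geometric)
        qed (use Z(2) in \<open>auto simp: M_def\<close>)
        finally have "Q * exp (- r' * \<kappa>) * M + (\<Sum>i\<in>I. w ^ fst i * M)
          \<le> (Q * exp (- r' * \<kappa>) + (real (card F))\<^sup>2 / (1 - w)) * M"
          by (simp add: algebra_simps)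
        also have "\<dots> \<le> Z * M"
          using Z by (intro mult_right_mono) (auto simp: M_def w_def)
        finally show ?thesis by (simp add: M_def Suc mult_ac)
      qed
      ultimately show ?thesis by (meson coverable_subset order.refl)
    qed
  qed
qed

end


section \<open>The Gurevic entropy is at most the chord entropy\<close>

context H_flow_speed
begin

text \<open>Expansivity asks for closeness at all times. The linear time change by
  \<open>T' / T\<close> maps one period onto the other, so closeness over one period repeats
  forever; within a period it moves times by at most \<open>\<bar>T' - T\<bar>\<close>, which costs
  the second half of \<epsilon>.\<close>

lemma close_periodic_orbits_agree:
  assumes expansive: "\<forall>x y. (\<exists>s :: real \<Rightarrow> real. continuous_on UNIV s \<and> s 0 = 0 \<and>
      (\<forall>t. dist (\<phi> t x) (\<phi> (s t) y) \<le> \<epsilon>)) \<longrightarrow> (\<exists>\<tau>\<in>{-\<nu>..\<nu>}. y = \<phi> \<tau> x)"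
    and T: "T > 0" "\<phi> T x = x" and T': "T' > 0" "\<phi> T' y = y" "b * \<bar>T' - T\<bar> \<le> \<epsilon> / 2"
    and close: "\<And>t. t \<in> {0..<T} \<Longrightarrow> dist (\<phi> t x) (\<phi> t y) \<le> \<epsilon> / 2"
  obtains \<tau> where "y = \<phi> \<tau> x"
proof -
  define s where "s t = t * (T' / T)" for t
  have "dist (\<phi> t x) (\<phi> (s t) y) \<le> \<epsilon>" for t
  proof -
    obtain u k where u: "0 \<le> u" "u < T" "t = u + of_int k * T"
      using real_mod_period[OF T(1)] by metis
    have "s t = s u + of_int k * T'" using u(3) T(1) by (simp add: s_def field_simps)
    then have "dist (\<phi> t x) (\<phi> (s t) y) = dist (\<phi> u x) (\<phi> (s u) y)"
      using u(3) T(2) T'(2) by (simp add: flow_period_multiple)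
    also have "\<dots> \<le> dist (\<phi> u x) (\<phi> u y) + b * \<bar>s u - u\<bar>"
      using dist_triangle[of "\<phi> u x" "\<phi> (s u) y" "\<phi> u y"] dist_flow_flow[of u y "s u"] by linarith
    also have "\<dots> \<le> \<epsilon>"
    proof -
      have "s u - u = (u / T) * (T' - T)" using T(1) by (simp add: s_def field_simps)
      then have "\<bar>s u - u\<bar> = (u / T) * \<bar>T' - T\<bar>" using u T(1) by (simp add: abs_mult)
      also have "\<dots> \<le> 1 * \<bar>T' - T\<bar>" using u T(1) by (intro mult_right_mono) auto
      finally have "b * \<bar>s u - u\<bar> \<le> b * \<bar>T' - T\<bar>" using speed_pos by simp
      then show ?thesis using close[of u] u T'(3) by simp
    qed
    finally show ?thesis .
  qed
  moreover have "continuous_on UNIV s" "s 0 = 0"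
    unfolding s_def using T(1) by (auto intro!: continuous_intros)
  ultimately show thesis using expansive that by blast
qed

text \<open>Assigning to each orbit a covering set that contains a base point is injective: orbits
  with the same set coincide by expansivity, and their periods lie in a common window shorter than
  any period.\<close>

lemma card_orbits_le:
  assumes expansive: "\<forall>x y. (\<exists>s :: real \<Rightarrow> real. continuous_on UNIV s \<and> s 0 = 0 \<and>
      (\<forall>t. dist (\<phi> t x) (\<phi> (s t) y) \<le> \<epsilon>)) \<longrightarrow> (\<exists>\<tau>\<in>{-\<nu>..\<nu>}. y = \<phi> \<tau> x)"
    and min_period: "\<And>x T. x \<in> X \<Longrightarrow> T > 0 \<Longrightarrow> \<phi> T x = x \<Longrightarrow> \<kappa> \<le> T"
    and \<kappa>: "0 < \<kappa>" "b * \<kappa> \<le> \<epsilon> / 2"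
    and cover: "coverable \<phi> (\<epsilon> / 2) (real n * \<kappa>) X R"
  defines "G \<equiv> {(range (\<lambda>t. \<phi> t x), T) | x T.
    x \<in> X \<and> T > 0 \<and> \<phi> T x = x \<and> (real n - 1) * \<kappa> \<le> T \<and> T < real n * \<kappa>}"
  shows "finite G" "real (card G) \<le> R"
proof -
  obtain P where P: "finite P" "real (card P) \<le> R" "X \<subseteq> \<Union>P"
    "\<forall>U\<in>P. \<forall>p\<in>U. \<forall>q\<in>U. \<forall>t\<in>{0..<real n * \<kappa>}. dist (\<phi> t p) (\<phi> t q) \<le> \<epsilon> / 2"
    using cover unfolding coverable_def by (elim exE conjE)
  define \<Phi> where "\<Phi> \<gamma> x U \<longleftrightarrow> \<gamma> = (range (\<lambda>t. \<phi> t x), snd \<gamma>) \<and> x \<in> X \<and> x \<in> U \<and> U \<in> P \<and>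
      snd \<gamma> > 0 \<and> \<phi> (snd \<gamma>) x = x \<and> (real n - 1) * \<kappa> \<le> snd \<gamma> \<and> snd \<gamma> < real n * \<kappa>"
    for \<gamma> x U
  have "\<exists>x U. \<Phi> \<gamma> x U" if \<gamma>: "\<gamma> \<in> G" for \<gamma>
  proof -
    obtain x T where x: "\<gamma> = (range (\<lambda>t. \<phi> t x), T)" "x \<in> X" "T > 0" "\<phi> T x = x"
      "(real n - 1) * \<kappa> \<le> T" "T < real n * \<kappa>"
      using \<gamma> unfolding G_def by blast
    then obtain U where "U \<in> P" "x \<in> U" using P(3) by blast
    then have "\<Phi> \<gamma> x U" using x by (simp add: \<Phi>_def)
    then show ?thesis by blast
  qed
  then obtain x U where "\<And>\<gamma>. \<gamma> \<in> G \<Longrightarrow> \<Phi> \<gamma> (x \<gamma>) (U \<gamma>)" by metis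
  note x = this[unfolded \<Phi>_def]
  have "inj_on U G"
  proof
    fix \<beta> \<gamma> assume \<beta>\<gamma>: "\<beta> \<in> G" "\<gamma> \<in> G" "U \<beta> = U \<gamma>"
    note \<beta> = x[OF \<beta>\<gamma>(1)] and \<gamma> = x[OF \<beta>\<gamma>(2)]
    have diff: "\<bar>snd \<gamma> - snd \<beta>\<bar> < \<kappa>" using \<beta> \<gamma> by (auto simp: algebra_simps)
    then have "b * \<bar>snd \<gamma> - snd \<beta>\<bar> \<le> b * \<kappa>" using speed_pos by simp
    then have "b * \<bar>snd \<gamma> - snd \<beta>\<bar> \<le> \<epsilon> / 2" using \<kappa>(2) by linarith
    moreover have "dist (\<phi> t (x \<beta>)) (\<phi> t (x \<gamma>)) \<le> \<epsilon> / 2" if "t \<in> {0..<snd \<beta>}" for t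
      using P(4) \<beta> \<gamma> \<beta>\<gamma>(3) that by auto
    ultimately obtain \<tau> where \<tau>: "x \<gamma> = \<phi> \<tau> (x \<beta>)"
      using close_periodic_orbits_agree[OF expansive, of "snd \<beta>" "x \<beta>" "snd \<gamma>" "x \<gamma>"] \<beta> \<gamma> by blast
    have "\<phi> t (x \<beta>) = \<phi> (t - \<tau>) (x \<gamma>)" "\<phi> t (x \<gamma>) = \<phi> (t + \<tau>) (x \<beta>)" for t
      unfolding \<tau> by (simp_all flip: flow_add)
    then have "range (\<lambda>t. \<phi> t (x \<beta>)) = range (\<lambda>t. \<phi> t (x \<gamma>))" by blast
    \<comment> \<open>The difference of two periods of a point fixes the point; if nonzero, its
      absolute value would be a period and thus at least \<kappa>.\<close>
    moreover have "snd \<beta> = snd \<gamma>"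
    proof -
      have "\<phi> (\<tau> + snd \<gamma>) (x \<beta>) = \<phi> \<tau> (x \<beta>)"
        using \<gamma> \<tau> by (simp add: flow_add add.commute[of \<tau>])
      then have "\<phi> (snd \<gamma>) (x \<beta>) = x \<beta>" by (metis flow_add flow_minus_cancel)
      then have "\<phi> (snd \<gamma> - snd \<beta>) (x \<beta>) = x \<beta>" "\<phi> (snd \<beta> - snd \<gamma>) (x \<beta>) = x \<beta>"
        using \<beta> flow_add[of "- snd \<beta>" "snd \<gamma>" "x \<beta>"] flow_add[of "- snd \<gamma>" "snd \<beta>" "x \<beta>"]
          flow_minus_cancel[of "snd \<beta>" "x \<beta>"] flow_minus_cancel[of "snd \<gamma>" "x \<beta>"]
        by (simp_all add: add.commute)
      then show ?thesis
        using min_period[of "x \<beta>" "snd \<gamma> - snd \<beta>"] min_period[of "x \<beta>" "snd \<beta> - snd \<gamma>"] diff \<beta>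
        by linarith
    qed
    ultimately show "\<beta> = \<gamma>" using \<beta> \<gamma> by metis
  qed
  moreover have "U ` G \<subseteq> P" using x by blast
  ultimately show "finite G" "real (card G) \<le> R"
    using P(1,2) inj_on_finite[of U G P] card_inj_on_le[of U G P] by auto
qed

lemma card_steps_le_time_in:
  assumes "compact K" "0 < \<kappa>" "T > 0" "\<phi> T x = x" "(real n - 1) * \<kappa> \<le> T"
  shows "(real (card (steps_in_hull K \<kappa> S n x)) - 1) * \<kappa>
    \<le> time_in \<phi> (range (\<lambda>t. \<phi> t x), T) (flow_hull K S)"
proof -
  \<comment> \<open>The last step may run past \<open>T\<close>, beyond what \<open>time_in\<close>
    measures; leaving it out accounts for the \<open>- 1\<close> in the bound.\<close>
  define J where "J = steps_in_hull K \<kappa> S n x - {n - 1}"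
  define I where "I j = {real j * \<kappa>..(real j + 1) * \<kappa>}" for j
  have "finite (steps_in_hull K \<kappa> S n x)" by (simp add: steps_in_hull_def)
  then have "finite J" and card: "card (steps_in_hull K \<kappa> S n x) \<le> card J + 1"
    by (auto simp: J_def card_Diff_singleton_if)
  let ?B = "{t \<in> {0..T}. \<phi> t x \<in> flow_hull K S}"
  have "(real (card (steps_in_hull K \<kappa> S n x)) - 1) * \<kappa> \<le> real (card J) * \<kappa>"
    using card \<open>0 < \<kappa>\<close> by (intro mult_right_mono) auto
  also have "\<dots> = (\<Sum>j\<in>J. measure lebesgue (I j))"
    using \<open>0 < \<kappa>\<close> by (simp add: I_def algebra_simps)
  also have "\<dots> = measure lebesgue (\<Union>j\<in>J. I j)"
  proof (rule measure_negligible_finite_Union_image[symmetric])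
    show "pairwise (\<lambda>i j. negligible (I i \<inter> I j)) J"
    proof (rule pairwiseI)
      fix i j :: nat assume "i \<noteq> j"
      have "I i \<inter> I j \<subseteq> {real (max i j) * \<kappa>}"
      proof
        fix t assume t: "t \<in> I i \<inter> I j"
        have "real (min i j) + 1 \<le> real (max i j)" using \<open>i \<noteq> j\<close> by linarith
        then have "(real (min i j) + 1) * \<kappa> \<le> real (max i j) * \<kappa>" using \<open>0 < \<kappa>\<close> by simp
        then show "t \<in> {real (max i j) * \<kappa>}"
          using t by (auto simp: I_def min_def max_def split: if_splits)
      qed
      then show "negligible (I i \<inter> I j)" by (rule negligible_subset[rotated]) simp
    qed
  qed (auto simp: I_def \<open>finite J\<close>)
  also have "\<dots> \<le> measure lebesgue ?B"
  proof (rule measure_mono_fmeasurable)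
    show "(\<Union>j\<in>J. I j) \<subseteq> ?B"
    proof
      fix t assume "t \<in> (\<Union>j\<in>J. I j)"
      then obtain j where j: "j \<in> J" "t \<in> I j" by blast
      then have "real j + 1 \<le> real n - 1" by (auto simp: J_def steps_in_hull_def)
      then have "(real j + 1) * \<kappa> \<le> (real n - 1) * \<kappa>" using \<open>0 < \<kappa>\<close> by simp
      moreover have "0 \<le> real j * \<kappa>" using \<open>0 < \<kappa>\<close> by simp
      ultimately have "t \<in> {0..T}" using j(2) assms(5) by (auto simp: I_def)
      then show "t \<in> ?B" using j by (auto simp: J_def I_def steps_in_hull_def)
    qed
    show "(\<Union>j\<in>J. I j) \<in> sets lebesgue" using \<open>finite J\<close> by (intro sets.finite_UN) (auto simp: I_def)
    have "?B = {0..T} \<inter> (\<lambda>t. \<phi> t x) -` flow_hull K S" by auto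
    moreover have "closed ((\<lambda>t. \<phi> t x) -` flow_hull K S)"
      using compact_flow_hull[OF assms(1)]
      by (intro closed_vimage continuous_intros) (auto intro: compact_imp_closed)
    ultimately show "?B \<in> lmeasurable"
      by (auto intro!: lmeasurable_compact compact_Int_closed)
  qed
  also have "\<dots> = time_in \<phi> (range (\<lambda>t. \<phi> t x), T) (flow_hull K S)"
    by (rule time_in_eq[OF assms(3,4) compact_imp_closed[OF compact_flow_hull[OF assms(1)]], symmetric])
  finally show ?thesis .
qed

text \<open>An orbit that meets the hull meets \<open>K\<close> itself and can be based at a point
  of \<open>K\<close>. Time 0 and the period are then the two visits that
  \<open>rare_visitors\<close> demands.\<close>

lemma orbits_rarely_in_hull:
  assumes "compact K" "0 < \<kappa>" "0 \<le> S" "0 < L"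
    and \<gamma>: "\<gamma> \<in> orbits_rarely_in \<phi> (flow_hull K S) \<alpha> L (L + \<sigma>)" and "0 \<le> \<alpha>"
    and c: "\<alpha> * (L + \<sigma>) / \<kappa> + 1 \<le> real c"
  obtains x T n where "\<gamma> = (range (\<lambda>t. \<phi> t x), T)" "x \<in> K" "x \<in> rare_visitors K \<kappa> S n c" "T > 0"
    "\<phi> T x = x" "L \<le> T" "T \<le> L + \<sigma>" "(real n - 1) * \<kappa> \<le> T" "T < real n * \<kappa>"
    "n \<in> {nat \<lfloor>L / \<kappa>\<rfloor> + 1..nat \<lfloor>(L + \<sigma>) / \<kappa>\<rfloor> + 1}"
proof -
  obtain y T where yT: "\<gamma> = (range (\<lambda>t. \<phi> t y), T)" "T > 0" "\<phi> T y = y"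
    using \<gamma> by (auto simp: orbits_rarely_in_def orbits_meeting_def periodic_orbits_def)
  have "L \<le> T" "T \<le> L + \<sigma>" "range (\<lambda>t. \<phi> t y) \<inter> flow_hull K S \<noteq> {}"
    "time_in \<phi> \<gamma> (flow_hull K S) < \<alpha> * T"
    using \<gamma> yT(1) unfolding orbits_rarely_in_def orbits_meeting_def by simp_all
  note y = yT this
  obtain t u x where x: "\<phi> t y = \<phi> u x" "x \<in> K" using y(6) by (auto simp: flow_hull_def)
  then have xy: "x = \<phi> (t - u) y" by (metis flow_add flow_minus_cancel uminus_add_conv_diff)
  have "\<phi> s y = \<phi> (s - (t - u)) x" "\<phi> s x = \<phi> (s + (t - u)) y" for s
    unfolding xy by (simp_all flip: flow_add)
  then have range: "range (\<lambda>t. \<phi> t y) = range (\<lambda>t. \<phi> t x)" by blast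
  have period: "\<phi> T x = x" unfolding xy using y(3) by (metis add.commute flow_add)
  define n where "n = nat \<lfloor>T / \<kappa>\<rfloor> + 1"
  have "real n = of_int \<lfloor>T / \<kappa>\<rfloor> + 1" using \<open>0 < \<kappa>\<close> y(2) by (simp add: n_def)
  then have "real n - 1 \<le> T / \<kappa>" "T / \<kappa> < real n" by linarith+
  then have n: "(real n - 1) * \<kappa> \<le> T" "T < real n * \<kappa>"
    using \<open>0 < \<kappa>\<close> by (simp_all add: field_simps)
  have "(real (card (steps_in_hull K \<kappa> S n x)) - 1) * \<kappa> < \<alpha> * T"
    using card_steps_le_time_in[OF assms(1,2) y(2) period n(1), of S] y(1,7) range by simp
  also have "\<dots> \<le> \<alpha> * (L + \<sigma>)" using y(5) \<open>0 \<le> \<alpha>\<close> by (simp add: mult_left_mono)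
  finally have "real (card (steps_in_hull K \<kappa> S n x)) < \<alpha> * (L + \<sigma>) / \<kappa> + 1"
    using \<open>0 < \<kappa>\<close> by (simp add: field_simps)
  then have "card (steps_in_hull K \<kappa> S n x) \<le> c" using c by linarith
  moreover have "\<exists>v\<in>{-\<kappa>..S}. \<phi> v x \<in> K"
    using x(2) \<open>0 < \<kappa>\<close> \<open>0 \<le> S\<close> by (intro bexI[of _ 0]) auto
  ultimately have "x \<in> rare_visitors K \<kappa> S n c"
    using n period x(2) unfolding rare_visitors_def by auto
  moreover have "n \<in> {nat \<lfloor>L / \<kappa>\<rfloor> + 1..nat \<lfloor>(L + \<sigma>) / \<kappa>\<rfloor> + 1}"
    using y(4,5) \<open>0 < \<kappa>\<close> unfolding n_def
    by (auto intro!: nat_mono floor_mono divide_right_mono)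
  ultimately show thesis using y x(2) n period range by (intro that[of x T n]) auto
qed

text \<open>The periods fall into boundedly many windows of length \<kappa>, counted separately. The
  bound splits into exponential growth in \<open>L\<close> and a factor free of \<open>L\<close>,
  the form suited to \<open>Limsup_elog_le\<close>.\<close>

lemma orbits_rarely_in_hull_bound:
  assumes expansive: "\<forall>x y. (\<exists>s :: real \<Rightarrow> real. continuous_on UNIV s \<and> s 0 = 0 \<and>
      (\<forall>t. dist (\<phi> t x) (\<phi> (s t) y) \<le> \<epsilon>)) \<longrightarrow> (\<exists>\<tau>\<in>{-\<nu>..\<nu>}. y = \<phi> \<tau> x)"
    and min_period: "\<And>x T. x \<in> K \<Longrightarrow> T > 0 \<Longrightarrow> \<phi> T x = x \<Longrightarrow> \<kappa> \<le> T"
    and "compact K" "0 < \<kappa>" "b * \<kappa> \<le> \<epsilon> / 2" "0 \<le> S" "0 < L" "0 \<le> \<alpha>" "0 \<le> \<sigma>" "1 \<le> Z"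
    and cover: "\<And>n c. coverable \<phi> (\<epsilon> / 2) (real n * \<kappa>) (rare_visitors K \<kappa> S n c)
      (exp (r * (real n * \<kappa>)) * Z ^ c)"
  obtains k where "ecard (orbits_rarely_in \<phi> (flow_hull K S) \<alpha> L (L + \<sigma>)) = enat k"
    "real k \<le> exp ((r + \<alpha> * ln Z / \<kappa>) * L) *
      ((\<sigma> / \<kappa> + 2) * exp (\<bar>r\<bar> * (\<sigma> + \<kappa>) + (\<alpha> * \<sigma> / \<kappa> + 2) * ln Z))"
proof -
  let ?O = "orbits_rarely_in \<phi> (flow_hull K S) \<alpha> L (L + \<sigma>)"
  define c where "c = nat \<lceil>\<alpha> * (L + \<sigma>) / \<kappa> + 1\<rceil>"
  have "0 \<le> \<alpha> * (L + \<sigma>) / \<kappa>" using assms(4,7-9) by simp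
  then have c: "\<alpha> * (L + \<sigma>) / \<kappa> + 1 \<le> real c" "real c \<le> \<alpha> * (L + \<sigma>) / \<kappa> + 2"
    unfolding c_def by linarith+
  \<comment> \<open>The intersection with \<open>K\<close> makes the lower bound on periods
    available.\<close>
  define G where "G n = {(range (\<lambda>t. \<phi> t x), T) | x T. x \<in> rare_visitors K \<kappa> S n c \<inter> K \<and>
    T > 0 \<and> \<phi> T x = x \<and> (real n - 1) * \<kappa> \<le> T \<and> T < real n * \<kappa>}" for n
  have min_period': "\<kappa> \<le> T" if "x \<in> rare_visitors K \<kappa> S n c \<inter> K" "T > 0" "\<phi> T x = x" for x n T
    using min_period that by blast
  have cover': "coverable \<phi> (\<epsilon> / 2) (real n * \<kappa>) (rare_visitors K \<kappa> S n c \<inter> K)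
      (exp (r * (real n * \<kappa>)) * Z ^ c)" for n
    by (rule coverable_subset[OF cover Int_lower1 order.refl])
  note card_G = card_orbits_le[OF expansive _ \<open>0 < \<kappa>\<close> \<open>b * \<kappa> \<le> \<epsilon> / 2\<close> cover', folded G_def]
  have G: "finite (G n)" "real (card (G n)) \<le> exp (r * (real n * \<kappa>)) * Z ^ c" for n
    using card_G[of n] min_period'[of _ n] by blast+
  define I where "I = {nat \<lfloor>L / \<kappa>\<rfloor> + 1..nat \<lfloor>(L + \<sigma>) / \<kappa>\<rfloor> + 1}"
  have sub: "?O \<subseteq> (\<Union>n\<in>I. G n)"
  proof
    fix \<gamma> assume "\<gamma> \<in> ?O"
    then show "\<gamma> \<in> (\<Union>n\<in>I. G n)"
    proof (rule orbits_rarely_in_hull[OF assms(3,4,6,7) _ \<open>0 \<le> \<alpha>\<close> c(1)])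
      fix x T n
      assume "\<gamma> = (range (\<lambda>t. \<phi> t x), T)" "x \<in> K" "x \<in> rare_visitors K \<kappa> S n c" "T > 0"
        "\<phi> T x = x" "(real n - 1) * \<kappa> \<le> T" "T < real n * \<kappa>"
        "n \<in> {nat \<lfloor>L / \<kappa>\<rfloor> + 1..nat \<lfloor>(L + \<sigma>) / \<kappa>\<rfloor> + 1}"
      then show ?thesis unfolding G_def I_def by blast
    qed
  qed
  have "finite (\<Union>n\<in>I. G n)" using G by (simp add: I_def)
  then have "finite ?O" using sub finite_subset by blast
  define M where "M = exp (r * L + \<bar>r\<bar> * (\<sigma> + \<kappa>)) * exp ((\<alpha> * (L + \<sigma>) / \<kappa> + 2) * ln Z)"
  have "real (card ?O) \<le> real (card (\<Union>n\<in>I. G n))"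
    using card_mono[OF \<open>finite (\<Union>n\<in>I. G n)\<close> sub] by simp
  also have "\<dots> \<le> (\<Sum>n\<in>I. real (card (G n)))"
    using card_UN_le[of I G] by (simp add: I_def flip: of_nat_sum)
  also have "\<dots> \<le> (\<Sum>n\<in>I. M)"
  proof (rule sum_mono)
    fix n assume "n \<in> I"
    have fl: "0 \<le> \<lfloor>L / \<kappa>\<rfloor>" "0 \<le> \<lfloor>(L + \<sigma>) / \<kappa>\<rfloor>" using assms(4,7-9) by simp_all
    have "int n \<le> \<lfloor>(L + \<sigma>) / \<kappa>\<rfloor> + 1" "\<lfloor>L / \<kappa>\<rfloor> + 1 \<le> int n"
      using \<open>n \<in> I\<close> fl unfolding I_def atLeastAtMost_iff by linarith+
    then have "real n \<le> (L + \<sigma>) / \<kappa> + 1" "L / \<kappa> \<le> real n" by linarith+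
    then have n: "real n * \<kappa> \<le> L + \<sigma> + \<kappa>" "L \<le> real n * \<kappa>"
      using \<open>0 < \<kappa>\<close> by (simp_all add: field_simps)
    \<comment> \<open>The rate may be negative, so the excess of \<open>n * \<kappa>\<close> over
      \<open>L\<close>, at most \<open>\<sigma> + \<kappa>\<close>, is estimated with
      \<open>\<bar>r\<bar>\<close>.\<close>
    have "r * (real n * \<kappa>) = r * L + r * (real n * \<kappa> - L)" by (simp add: algebra_simps)
    also have "r * (real n * \<kappa> - L) \<le> \<bar>r\<bar> * (real n * \<kappa> - L)"
      using n by (intro mult_right_mono) auto
    also have "\<dots> \<le> \<bar>r\<bar> * (\<sigma> + \<kappa>)" using n by (intro mult_left_mono) auto
    finally have "exp (r * (real n * \<kappa>)) \<le> exp (r * L + \<bar>r\<bar> * (\<sigma> + \<kappa>))" by simp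
    moreover have "Z ^ c = exp (real c * ln Z)" using \<open>1 \<le> Z\<close> by (simp add: exp_of_nat_mult)
    then have "Z ^ c \<le> exp ((\<alpha> * (L + \<sigma>) / \<kappa> + 2) * ln Z)"
      using c(2) \<open>1 \<le> Z\<close> by (simp add: mult_right_mono)
    ultimately have "exp (r * (real n * \<kappa>)) * Z ^ c \<le> M"
      unfolding M_def using \<open>1 \<le> Z\<close> by (intro mult_mono) auto
    then show "real (card (G n)) \<le> M" using G(2)[of n] by linarith
  qed
  also have "\<dots> = real (card I) * M" by simp
  also have "\<dots> \<le> (\<sigma> / \<kappa> + 2) * M"
  proof (rule mult_right_mono)
    have "(L + \<sigma>) / \<kappa> = L / \<kappa> + \<sigma> / \<kappa>" by (simp add: add_divide_distrib)
    moreover have "0 \<le> L / \<kappa>" "0 \<le> \<sigma> / \<kappa>" using assms(4,7-9) by simp_all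
    ultimately show "real (card I) \<le> \<sigma> / \<kappa> + 2" unfolding I_def by simp linarith
  qed (simp add: M_def)
  also have "\<dots> = exp ((r + \<alpha> * ln Z / \<kappa>) * L) *
      ((\<sigma> / \<kappa> + 2) * exp (\<bar>r\<bar> * (\<sigma> + \<kappa>) + (\<alpha> * \<sigma> / \<kappa> + 2) * ln Z))"
  proof -
    have eq: "(r * L + \<bar>r\<bar> * (\<sigma> + \<kappa>)) + (\<alpha> * (L + \<sigma>) / \<kappa> + 2) * ln Z =
      (r + \<alpha> * ln Z / \<kappa>) * L + (\<bar>r\<bar> * (\<sigma> + \<kappa>) + (\<alpha> * \<sigma> / \<kappa> + 2) * ln Z)"
      by (simp add: algebra_simps add_divide_distrib)
    have "M = exp ((r + \<alpha> * ln Z / \<kappa>) * L) * exp (\<bar>r\<bar> * (\<sigma> + \<kappa>) + (\<alpha> * \<sigma> / \<kappa> + 2) * ln Z)"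
      unfolding M_def exp_add[symmetric] eq ..
    then show ?thesis by (simp only: mult_ac)
  qed
  finally show thesis using \<open>finite ?O\<close> by (intro that[of "card ?O"]) (simp add: ecard_def)
qed

end


text \<open>Squaring \<open>x \<le> exp x\<close> at \<open>x = s * T / 2\<close> puts a quadratic
  function below the exponential.\<close>

lemma eventually_affine_le_exp:
  fixes A B s :: real
  assumes "s > 0"
  shows "\<forall>\<^sub>F T in at_top. A * T + B \<le> exp (s * T)"
  using eventually_ge_at_top[of "max 1 (4 * (\<bar>A\<bar> + \<bar>B\<bar>) / s\<^sup>2)"]
proof eventually_elim
  case (elim T)
  then have T: "1 \<le> T" "\<bar>A\<bar> + \<bar>B\<bar> \<le> s\<^sup>2 * T / 4" using assms by (simp_all add: field_simps)
  have "A * T \<le> \<bar>A\<bar> * T" "B \<le> \<bar>B\<bar> * T"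
    using T(1) mult_left_mono[of 1 T "\<bar>B\<bar>"] by (auto intro: mult_right_mono)
  then have "A * T + B \<le> (\<bar>A\<bar> + \<bar>B\<bar>) * T" by (simp add: distrib_right)
  also have "\<dots> \<le> (s\<^sup>2 * T / 4) * T" using T by (intro mult_right_mono) auto
  also have "\<dots> = (s * T / 2)\<^sup>2" by (simp add: power2_eq_square)
  also have "\<dots> \<le> (exp (s * T / 2))\<^sup>2"
  proof (rule power_mono)
    show "s * T / 2 \<le> exp (s * T / 2)" using exp_ge_add_one_self[of "s * T / 2"] by linarith
  qed (use assms T(1) in simp)
  also have "\<dots> = exp (s * T)" by (simp flip: exp_double)
  finally show ?case .
qed

section \<open>Choice of the parameters and passage to small \<alpha>\<close>

context H_flow_speed
begin

lemma chords_coverable: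
  assumes "chord_number \<phi> K x y \<eta> T (T + C) \<delta> = enat k" "real k \<le> R" "\<delta> > 0"
  shows "coverable \<phi> (2 * \<delta>) T (chords \<phi> K x y \<eta> T (T + C)) R"
proof -
  obtain E where E: "finite E" "card E \<le> k"
    "chords \<phi> K x y \<eta> T (T + C) \<subseteq> (\<Union>z\<in>E. dyn_ball \<phi> z \<delta> T)"
    using chords_spanning_set[OF \<open>\<delta> > 0\<close> assms(1)] by blast
  have "dist (\<phi> t p) (\<phi> t q) \<le> 2 * \<delta>"
    if pq: "p \<in> dyn_ball \<phi> z \<delta> T" "q \<in> dyn_ball \<phi> z \<delta> T" "t \<in> {0..<T}" for p q z t
    using pq dist_triangle3[of "\<phi> t p" "\<phi> t q" "\<phi> t z"] by (force simp: dyn_ball_def)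
  moreover have "card ((\<lambda>z. dyn_ball \<phi> z \<delta> T) ` E) \<le> k"
    using E card_image_le le_trans by blast
  then have "real (card ((\<lambda>z. dyn_ball \<phi> z \<delta> T) ` E)) \<le> R" using assms(2) by linarith
  ultimately show ?thesis
    unfolding coverable_def using E by (intro exI[of _ "(\<lambda>z. dyn_ball \<phi> z \<delta> T) ` E"]) auto
qed

lemma gurevic_entropy_le:
  assumes "compact K" "interior K \<noteq> {}" "0 < \<sigma>" "0 < C"
    and chord: "(SUP \<delta>\<in>{0<..}. INF \<eta>\<in>{0<..}. chord_entropy_outside C \<phi> K \<delta> \<eta>) < ereal r"
    and "r < r'"
  obtains K' where "compact K'" "interior K' \<noteq> {}"
    "(INF \<alpha>\<in>{0<..}. gurevic_entropy_outside \<sigma> \<phi> K' \<alpha>) \<le> ereal r'"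
proof -
  obtain \<epsilon> where "\<epsilon> > 0" and expansive: "\<forall>x y. (\<exists>s :: real \<Rightarrow> real. continuous_on UNIV s \<and> s 0 = 0 \<and>
      (\<forall>t. dist (\<phi> t x) (\<phi> (s t) y) \<le> \<epsilon>)) \<longrightarrow> (\<exists>\<tau>\<in>{-1..1}. y = \<phi> \<tau> x)"
    using expansivity[of 1] by (auto simp only: zero_less_one)
  \<comment> \<open>Dynamical balls of radius \<delta> then have diameter at most
    \<open>\<epsilon> / 2\<close>, the closeness required of orbits with the same code.\<close>
  define \<delta> where "\<delta> = \<epsilon> / 4"
  have "\<delta> > 0" "\<epsilon> / 2 = 2 * \<delta>" using \<open>\<epsilon> > 0\<close> by (simp_all add: \<delta>_def)
  then have "(INF \<eta>\<in>{0<..}. chord_entropy_outside C \<phi> K \<delta> \<eta>) < ereal r"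
    by (intro SUP_lessD[OF chord]) simp
  then obtain \<eta> where "\<eta> > 0" and \<eta>: "chord_entropy_outside C \<phi> K \<delta> \<eta> < ereal r"
    by (auto simp: INF_less_iff)
  have rate: "\<forall>\<^sub>F T in at_top. \<exists>k. chord_number \<phi> K x y \<eta> T (T + C) \<delta> = enat k \<and> real k \<le> exp (r * T)"
    if "x \<in> frontier K" "y \<in> frontier K" for x y
    using \<eta> that unfolding chord_entropy_outside_def
    by (intro eventually_le_exp_if_Limsup_less) (blast dest: SUP_lessD)
  obtain p where "p > 0" and p: "\<And>x T. x \<in> K \<Longrightarrow> T > 0 \<Longrightarrow> \<phi> T x = x \<Longrightarrow> p \<le> T"
    using periods_bounded_below[OF \<open>compact K\<close>] by blast
  \<comment> \<open>The step is no longer than any period of a point of \<open>K\<close>, short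
    enough for the Lipschitz condition, and moves points by at most \<open>\<epsilon> / 2\<close>
    (comparison of periods) and by less than \<open>\<eta> / 2\<close> (ends of chords).\<close>
  define \<kappa> where "\<kappa> = min (min p 1) (min (\<epsilon> / (2 * b)) (\<eta> / (4 * b)))"
  have "0 < \<kappa>" using \<open>p > 0\<close> \<open>\<epsilon> > 0\<close> \<open>\<eta> > 0\<close> speed_pos by (simp add: \<kappa>_def)
  have "\<kappa> \<le> \<epsilon> / (2 * b)" "\<kappa> \<le> \<eta> / (4 * b)" "\<kappa> \<le> 1" "\<kappa> \<le> p" unfolding \<kappa>_def by linarith+
  then have "b * \<kappa> \<le> \<epsilon> / 2" "b * \<kappa> \<le> \<eta> / 4" using speed_pos by (simp_all add: field_simps)
  then have "b * \<kappa> < \<eta> / 2" using \<open>\<eta> > 0\<close> by linarith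
  have "closed K" using \<open>compact K\<close> by (rule compact_imp_closed)
  then have "compact (frontier K)"
    using \<open>compact K\<close> by (metis compact_Int_closed frontier_closed frontier_subset_closed inf.absorb2)
  \<comment> \<open>The time from which the chord bound holds depends on the end points. With
    finitely many pairs these times have a common bound, from which \<open>S\<close> is
    built.\<close>
  then obtain F where F: "finite F" "F \<subseteq> frontier K" "frontier K \<subseteq> (\<Union>x\<in>F. ball x (\<eta> / 2))"
    using seq_compact_imp_totally_bounded[OF compact_imp_seq_compact] \<open>\<eta> > 0\<close> half_gt_zero by metis
  have "\<forall>\<^sub>F T in at_top. \<forall>z\<in>F \<times> F. \<exists>k. chord_number \<phi> K (fst z) (snd z) \<eta> T (T + C) \<delta> = enat k \<and>
      real k \<le> exp (r * T)"
    using F by (intro eventually_ball_finite) (auto intro!: rate)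
  then obtain S0 where "\<forall>T\<ge>S0. \<forall>z\<in>F \<times> F.
      \<exists>k. chord_number \<phi> K (fst z) (snd z) \<eta> T (T + C) \<delta> = enat k \<and> real k \<le> exp (r * T)"
    unfolding eventually_at_top_linorder by blast
  then have S0: "\<exists>k. chord_number \<phi> K x y \<eta> T (T + C) \<delta> = enat k \<and> real k \<le> exp (r * T)"
    if "S0 \<le> T" "x \<in> F" "y \<in> F" for T x y
    using that by force
  define S where "S = max S0 (2 * \<kappa>)"
  have chords: "coverable \<phi> (\<epsilon> / 2) T (chords \<phi> K x y \<eta> T (T + C)) (exp (r * T))"
    if "x \<in> F" "y \<in> F" "S \<le> T" for x y T
    using S0[of T x y] that chords_coverable \<open>\<delta> > 0\<close> unfolding \<open>\<epsilon> / 2 = 2 * \<delta>\<close>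
    by (auto simp: S_def)
  have "2 * \<kappa> \<le> S" "0 \<le> S" using \<open>0 < \<kappa>\<close> by (auto simp: S_def)
  define K' where "K' = flow_hull K S"
  have "compact K'" unfolding K'_def by (rule compact_flow_hull[OF \<open>compact K\<close>])
  then obtain Q where Q: "coverable \<phi> (\<epsilon> / 2) \<kappa> (flow_hull K S) Q"
    using compact_coverable[of K' "\<epsilon> / 2" \<kappa>] \<open>\<epsilon> > 0\<close> \<open>\<kappa> \<le> 1\<close> unfolding K'_def by auto
  define Z where "Z = max 1 (Q * exp (- r' * \<kappa>) + (real (card F))\<^sup>2 / (1 - exp ((r - r') * \<kappa>)))"
  have "1 \<le> Z" by (simp add: Z_def)
  have net: "\<exists>y\<in>F. dist y x < \<eta> / 2" if "x \<in> frontier K" for x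
  proof -
    obtain y where "y \<in> F" "x \<in> ball y (\<eta> / 2)" using F(3) \<open>x \<in> frontier K\<close> by blast
    then show ?thesis by auto
  qed
  have cover: "coverable \<phi> (\<epsilon> / 2) (real n * \<kappa>) (rare_visitors K \<kappa> S n c)
      (exp (r' * (real n * \<kappa>)) * Z ^ c)" for n c
    using \<open>0 < C\<close>
    by (intro rare_visitors_coverable[OF \<open>0 < \<kappa>\<close> \<open>2 * \<kappa> \<le> S\<close> \<open>closed K\<close> _ \<open>b * \<kappa> < \<eta> / 2\<close> net
          \<open>finite F\<close> Q chords \<open>r < r'\<close> _ \<open>1 \<le> Z\<close>]) (simp_all add: Z_def)
  have "gurevic_entropy_outside \<sigma> \<phi> K' \<alpha> \<le> ereal (r' + \<alpha> * ln Z / \<kappa>)" if "\<alpha> > 0" for \<alpha>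
    unfolding gurevic_entropy_outside_def
  proof (rule Limsup_elog_le)
    let ?D = "(\<sigma> / \<kappa> + 2) * exp (\<bar>r'\<bar> * (\<sigma> + \<kappa>) + (\<alpha> * \<sigma> / \<kappa> + 2) * ln Z)"
    have min_period: "\<kappa> \<le> T" if "x \<in> K" "T > 0" "\<phi> T x = x" for x T
      using p[OF that] \<open>\<kappa> \<le> p\<close> by simp
    show "\<forall>\<^sub>F L in at_top. \<exists>k. ecard (orbits_rarely_in \<phi> K' \<alpha> L (L + \<sigma>)) = enat k \<and>
        real k \<le> exp ((r' + \<alpha> * ln Z / \<kappa>) * L) * ?D"
      using eventually_gt_at_top[of 0]
    proof eventually_elim
      case (elim L)
      show ?case
        unfolding K'_def
        by (rule orbits_rarely_in_hull_bound[OF expansive min_period \<open>compact K\<close> \<open>0 < \<kappa>\<close>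
              \<open>b * \<kappa> \<le> \<epsilon> / 2\<close> \<open>0 \<le> S\<close> elim less_imp_le[OF \<open>\<alpha> > 0\<close>]
              less_imp_le[OF \<open>0 < \<sigma>\<close>] \<open>1 \<le> Z\<close> cover]) (assumption | intro exI conjI)+
    qed
    show "\<forall>\<^sub>F L in at_top. ?D \<le> exp (s * L)" if "s > 0" for s
      using eventually_affine_le_exp[OF that, of 0 ?D] by simp
  qed
  then have limit: "(INF \<alpha>\<in>{0<..}. gurevic_entropy_outside \<sigma> \<phi> K' \<alpha>) \<le> ereal (r' + \<alpha> * ln Z / \<kappa>)"
    if "\<alpha> > 0" for \<alpha>
    using that by (intro INF_lower2[of \<alpha>]) auto
  have "(INF \<alpha>\<in>{0<..}. gurevic_entropy_outside \<sigma> \<phi> K' \<alpha>) \<le> ereal r'"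
  proof (rule ereal_le_epsilon2)
    fix e :: real assume "e > 0"
    have "0 \<le> ln Z" using \<open>1 \<le> Z\<close> by simp
    \<comment> \<open>Chosen so that \<open>\<alpha> * ln Z / \<kappa> \<le> e\<close>; adding 1 to
      \<open>ln Z\<close> avoids division by 0 when \<open>Z = 1\<close>.\<close>
    define \<alpha> where "\<alpha> = e * \<kappa> / (1 + ln Z)"
    have "\<alpha> > 0" using \<open>e > 0\<close> \<open>0 < \<kappa>\<close> \<open>0 \<le> ln Z\<close> by (simp add: \<alpha>_def)
    moreover have "\<alpha> * ln Z / \<kappa> = e * (ln Z / (1 + ln Z))" using \<open>0 < \<kappa>\<close> by (simp add: \<alpha>_def)
    moreover have "ln Z / (1 + ln Z) \<le> 1" using \<open>0 \<le> ln Z\<close> by simp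
    then have "e * (ln Z / (1 + ln Z)) \<le> e * 1" using \<open>e > 0\<close> by (intro mult_left_mono) auto
    ultimately have "r' + \<alpha> * ln Z / \<kappa> \<le> r' + e" by linarith
    then have "ereal (r' + \<alpha> * ln Z / \<kappa>) \<le> ereal r' + ereal e" by simp
    then show "(INF \<alpha>\<in>{0<..}. gurevic_entropy_outside \<sigma> \<phi> K' \<alpha>) \<le> ereal r' + ereal e"
      using limit[OF \<open>\<alpha> > 0\<close>] by (rule order.trans[rotated])
  qed
  moreover have "interior K' \<noteq> {}"
    using \<open>interior K \<noteq> {}\<close> interior_mono[OF subset_flow_hull[OF \<open>0 \<le> S\<close>, of K]]
    unfolding K'_def by blast
  ultimately show thesis using that \<open>compact K'\<close> by blast
qed

end


section \<open>The chord entropy is at most the Gurevic entropy\<close>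

context H_flow
begin

text \<open>The constants of the closing lemma depend on the centre \<open>x\<close>. A net of mesh
  \<open>\<epsilon> / 2\<close> leaves finitely many centres, with every point within
  \<open>\<epsilon> / 2\<close> of \<open>K\<close> still inside one of their
  \<epsilon>-balls.\<close>

lemma uniform_closing:
  fixes K :: "'a set"
  assumes "compact K" "\<epsilon> > 0"
  obtains \<delta> Tmin where "\<delta> > 0" "\<And>x y t. x \<in> K \<Longrightarrow> dist x y < \<epsilon> / 2 \<Longrightarrow> t \<ge> Tmin \<Longrightarrow> dist (\<phi> t y) y \<le> \<delta> \<Longrightarrow>
    \<exists>z\<in>ball y \<epsilon>. \<exists>\<tau>\<in>{t - \<epsilon>..t + \<epsilon>}. \<phi> \<tau> z = z \<and> (\<forall>s\<in>{0..t}. dist (\<phi> s z) (\<phi> s y) \<le> \<epsilon>)"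
proof -
  have "\<exists>d>0. \<exists>T. \<forall>y\<in>ball x \<epsilon>. \<forall>t\<ge>T. dist (\<phi> t y) y \<le> d \<longrightarrow>
    (\<exists>z\<in>ball y \<epsilon>. \<exists>\<tau>\<in>{t - \<epsilon>..t + \<epsilon>}. \<phi> \<tau> z = z \<and> (\<forall>s\<in>{0..t}. dist (\<phi> s z) (\<phi> s y) \<le> \<epsilon>))" for x
    using closing[OF \<open>\<epsilon> > 0\<close>, of x] by blast
  then obtain d T where d: "\<And>x. d x > 0" and close: "\<And>x y t. y \<in> ball x \<epsilon> \<Longrightarrow> t \<ge> T x \<Longrightarrow>
    dist (\<phi> t y) y \<le> d x \<Longrightarrow>
    \<exists>z\<in>ball y \<epsilon>. \<exists>\<tau>\<in>{t - \<epsilon>..t + \<epsilon>}. \<phi> \<tau> z = z \<and> (\<forall>s\<in>{0..t}. dist (\<phi> s z) (\<phi> s y) \<le> \<epsilon>)"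
    by metis
  obtain F where F: "finite F" "K \<subseteq> (\<Union>x\<in>F. ball x (\<epsilon> / 2))"
    using assms by (metis compact_eq_totally_bounded half_gt_zero)
  define \<delta> where "\<delta> = Min (insert 1 (d ` F))"
  define Tmin where "Tmin = Max (insert 0 (T ` F))"
  show thesis
  proof
    show "\<delta> > 0" using F d by (auto simp: \<delta>_def)
    fix x y t assume x: "x \<in> K" "dist x y < \<epsilon> / 2" "t \<ge> Tmin" "dist (\<phi> t y) y \<le> \<delta>"
    then obtain f where f: "f \<in> F" "dist f x < \<epsilon> / 2" using F by auto
    have "y \<in> ball f \<epsilon>" using f x(2) dist_triangle[of f y x] by simp
    moreover have "\<delta> \<le> d f" unfolding \<delta>_def using F f by (intro Min_le) auto
    moreover have "T f \<le> Tmin" unfolding Tmin_def using F f by (intro Max_ge) auto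
    ultimately show "\<exists>z\<in>ball y \<epsilon>. \<exists>\<tau>\<in>{t - \<epsilon>..t + \<epsilon>}. \<phi> \<tau> z = z \<and>
        (\<forall>s\<in>{0..t}. dist (\<phi> s z) (\<phi> s y) \<le> \<epsilon>)"
      using close[of y f t] x by simp
  qed
qed

lemma ex_connecting_orbit:
  assumes "\<eta> > 0"
  obtains p t where "t \<ge> 1" "p \<in> ball x \<eta>" "\<phi> t p \<in> ball y \<eta>"
proof -
  have "ball x \<eta> \<noteq> {}" "ball y \<eta> \<noteq> {}" using assms by simp_all
  then have "\<exists>t\<ge>1. \<phi> t ` ball x \<eta> \<inter> ball y \<eta> \<noteq> {}" by (intro transitivity) auto
  then show thesis using that by blast
qed

text \<open>The chord from \<open>x\<close> to \<open>y\<close> is followed by connecting orbits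
  from \<open>y\<close> to \<open>q\<close> and from \<open>q\<close> to \<open>x\<close>. Shadowing
  these three pieces gives an almost closed orbit, which the closing lemma closes. The detour
  through \<open>q\<close> makes the periodic orbit meet a prescribed place. The connecting orbits,
  and with them \<open>c\<close>, are fixed before the chord is chosen.\<close>

lemma close_chords:
  fixes K :: "'a set"
  assumes "compact K" "\<epsilon> > 0"
  obtains \<eta> where "\<eta> > 0" and "\<And>x y q. x \<in> K \<Longrightarrow> y \<in> K \<Longrightarrow> q \<in> K \<Longrightarrow>
    \<exists>c\<ge>1. \<exists>T\<^sub>0. \<forall>z \<tau>. z \<in> ball x \<eta> \<longrightarrow> \<phi> \<tau> z \<in> ball y \<eta> \<longrightarrow> T\<^sub>0 \<le> \<tau> \<longrightarrow>
      (\<exists>z' \<tau>'. \<bar>\<tau>' - (\<tau> + c)\<bar> \<le> \<epsilon> \<and> \<phi> \<tau>' z' = z' \<and>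
        (\<forall>s\<in>{0..\<tau>}. dist (\<phi> s z') (\<phi> s z) \<le> 2 * \<epsilon>) \<and> (\<exists>s. dist (\<phi> s z') q < 3 * \<epsilon>))"
proof -
  obtain K' \<rho> where K': "compact K'" "\<rho> > 0" "\<And>x. x \<in> K \<Longrightarrow> ball x \<rho> \<subseteq> K'"
    using compact_neighbourhood[OF \<open>compact K\<close>] by blast
  obtain \<delta> Tmin where "\<delta> > 0" and closing': "\<And>x y t. x \<in> K \<Longrightarrow> dist x y < \<epsilon> / 2 \<Longrightarrow> t \<ge> Tmin \<Longrightarrow>
    dist (\<phi> t y) y \<le> \<delta> \<Longrightarrow>
    \<exists>z\<in>ball y \<epsilon>. \<exists>\<tau>\<in>{t - \<epsilon>..t + \<epsilon>}. \<phi> \<tau> z = z \<and> (\<forall>s\<in>{0..t}. dist (\<phi> s z) (\<phi> s y) \<le> \<epsilon>)"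
    using uniform_closing[OF assms] by blast
  \<comment> \<open>With \<eta> at most \<theta>, the shadowing point starts within
    \<open>2 * \<theta> \<le> \<epsilon> / 2\<close> of \<open>x\<close> and returns to within
    \<open>4 * \<theta> \<le> \<delta>\<close> of itself.\<close>
  define \<theta> where "\<theta> = min (\<epsilon> / 4) (\<delta> / 4)"
  have \<theta>: "\<theta> > 0" "\<theta> \<le> \<epsilon> / 4" "\<theta> \<le> \<delta> / 4" using \<open>\<epsilon> > 0\<close> \<open>\<delta> > 0\<close> by (auto simp: \<theta>_def)
  obtain \<eta>s where "\<eta>s > 0" and shadow: "\<forall>(x :: nat \<Rightarrow> 'a) (t :: nat \<Rightarrow> real).
        (\<forall>i\<in>{1..3}. x i \<in> K' \<and> t i \<ge> 0) \<and>
        (\<forall>i\<in>{1..<3}. dist (\<phi> (t i) (x i)) (x (i + 1)) < \<eta>s) \<longrightarrow>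
        (\<exists>y. \<forall>i\<in>{1..3}. \<forall>s\<in>{0..t i}. dist (\<phi> (s + (\<Sum>j = 1..<i. t j)) y) (\<phi> s (x i)) < \<theta>)"
    using finite_exact_shadowing[OF K'(1) \<theta>(1), of 3] by force
  \<comment> \<open>Two points of one ball of radius \<open>\<eta>s / 2\<close> are less than
    \<open>\<eta>s\<close> apart, as needed at the junctions; the bound by \<rho> keeps the starting
    points of the pieces in \<open>K'\<close>.\<close>
  define \<eta> where "\<eta> = min \<theta> (min (\<eta>s / 2) \<rho>)"
  have \<eta>: "\<eta> > 0" "\<eta> \<le> \<theta>" "\<eta> \<le> \<eta>s / 2" "\<eta> \<le> \<rho>"
    using \<theta> \<open>\<eta>s > 0\<close> \<open>\<rho> > 0\<close> by (auto simp: \<eta>_def)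
  show thesis
  proof
    show "\<eta> > 0" by fact
    fix x y q assume K: "x \<in> K" "y \<in> K" "q \<in> K"
    obtain p t where p: "t \<ge> 1" "p \<in> ball y \<eta>" "\<phi> t p \<in> ball q \<eta>"
      by (rule ex_connecting_orbit[OF \<eta>(1)])
    obtain p' t' where p': "t' \<ge> 1" "p' \<in> ball q \<eta>" "\<phi> t' p' \<in> ball x \<eta>"
      by (rule ex_connecting_orbit[OF \<eta>(1)])
    have "\<exists>z' \<tau>'. \<bar>\<tau>' - (\<tau> + (t + t'))\<bar> \<le> \<epsilon> \<and> \<phi> \<tau>' z' = z' \<and>
        (\<forall>s\<in>{0..\<tau>}. dist (\<phi> s z') (\<phi> s z) \<le> 2 * \<epsilon>) \<and> (\<exists>s. dist (\<phi> s z') q < 3 * \<epsilon>)"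
      if z: "z \<in> ball x \<eta>" "\<phi> \<tau> z \<in> ball y \<eta>" "max 0 Tmin \<le> \<tau>" for z \<tau>
    proof -
      define X where "X i = (if i = 1 then z else if i = 2 then p else p')" for i :: nat
      define \<T> where "\<T> i = (if i = 1 then \<tau> else if i = 2 then t else t')" for i :: nat
      have "u \<in> K'" if "u \<in> ball v \<eta>" "v \<in> K" for u v using K'(3)[OF that(2)] that(1) \<eta>(4) by auto
      then have "\<forall>i\<in>{1..3}. X i \<in> K' \<and> \<T> i \<ge> 0"
        using K p p' z by (auto simp: X_def \<T>_def)
      moreover have "dist (\<phi> (\<T> i) (X i)) (X (i + 1)) < \<eta>s" if "i \<in> {1..<3}" for i
      proof -
        have "dist u u' < \<eta>s" if "u \<in> ball v \<eta>" "u' \<in> ball v \<eta>" for u u' v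
          using that \<eta>(3) dist_triangle3[of u u' v] by simp
        moreover have "i = 1 \<or> i = 2" using that by auto
        ultimately show ?thesis using z(2) p p' by (auto simp: X_def \<T>_def)
      qed
      ultimately obtain w where w: "\<And>i s. i \<in> {1..3} \<Longrightarrow> s \<in> {0..\<T> i} \<Longrightarrow>
          dist (\<phi> (s + (\<Sum>j = 1..<i. \<T> j)) w) (\<phi> s (X i)) < \<theta>"
        using shadow by blast
      have w1: "dist (\<phi> s w) (\<phi> s z) < \<theta>" if "s \<in> {0..\<tau>}" for s
        using w[of 1 s] that by (simp add: X_def \<T>_def)
      have sum: "(\<Sum>j = 1..<3. \<T> j) = \<tau> + t"
        by (simp add: numeral_3_eq_3 \<T>_def)
      then have w3: "dist (\<phi> (s + (\<tau> + t)) w) (\<phi> s p') < \<theta>" if "s \<in> {0..t'}" for s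
        using w[of 3 s] that by (simp add: X_def \<T>_def)
      define R where "R = \<tau> + (t + t')"
      have "dist z w < \<theta>" using w1[of 0] z(3) by (simp add: dist_commute)
      have "dist x w < \<epsilon> / 2"
        using \<open>dist z w < \<theta>\<close> z(1) \<eta>(2) \<theta>(2) dist_triangle[of x w z] by simp
      moreover have "dist (\<phi> R w) w \<le> \<delta>"
      proof -
        have "dist (\<phi> R w) (\<phi> t' p') < \<theta>" using w3[of t'] p' by (simp add: R_def ac_simps)
        moreover have "dist (\<phi> t' p') x < \<eta>" "dist x z < \<eta>" using p' z by (simp_all add: dist_commute)
        ultimately show ?thesis
          using \<open>dist z w < \<theta>\<close> \<eta>(2) \<theta>(3) dist_triangle[of "\<phi> R w" w "\<phi> t' p'"]
            dist_triangle[of "\<phi> t' p'" w x] dist_triangle[of x w z] by linarith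
      qed
      moreover have "R \<ge> Tmin" using z(3) p p' by (simp add: R_def)
      ultimately have "\<exists>z\<in>ball w \<epsilon>. \<exists>\<tau>\<in>{R - \<epsilon>..R + \<epsilon>}. \<phi> \<tau> z = z \<and>
          (\<forall>s\<in>{0..R}. dist (\<phi> s z) (\<phi> s w) \<le> \<epsilon>)"
        by (intro closing'[OF K(1)])
      then obtain z' \<tau>' where z': "\<tau>' \<in> {R - \<epsilon>..R + \<epsilon>}" "\<phi> \<tau>' z' = z'"
        "\<forall>s\<in>{0..R}. dist (\<phi> s z') (\<phi> s w) \<le> \<epsilon>"
        by (elim bexE conjE)
      have "dist (\<phi> s z') (\<phi> s z) \<le> 2 * \<epsilon>" if "s \<in> {0..\<tau>}" for s
        using bspec[OF z'(3), of s] w1[OF that] that p p' \<theta> dist_triangle[of "\<phi> s z'" "\<phi> s z" "\<phi> s w"]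
        by (simp add: R_def)
      \<comment> \<open>At time \<open>\<tau> + t\<close> the third piece starts, at
        \<open>p'\<close> near \<open>q\<close>; closing, shadowing and the choice of
        \<open>p'\<close> contribute the errors \<epsilon>, \<theta> and \<eta>.\<close>
      moreover have "dist (\<phi> (\<tau> + t) z') q < 3 * \<epsilon>"
      proof -
        have "dist (\<phi> (\<tau> + t) z') (\<phi> (\<tau> + t) w) \<le> \<epsilon>"
          using bspec[OF z'(3), of "\<tau> + t"] z(3) p p' by (simp add: R_def)
        moreover have "dist (\<phi> (\<tau> + t) w) p' < \<theta>" using w3[of 0] p' by simp
        moreover have "dist p' q < \<eta>" using p' by (simp add: dist_commute)
        ultimately show ?thesis
          using \<eta>(2) \<theta>(1,2) dist_triangle[of "\<phi> (\<tau> + t) z'" q "\<phi> (\<tau> + t) w"]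
            dist_triangle[of "\<phi> (\<tau> + t) w" q p'] by linarith
      qed
      moreover have "\<bar>\<tau>' - (\<tau> + (t + t'))\<bar> \<le> \<epsilon>" using z'(1) by (auto simp: R_def)
      ultimately show ?thesis using z'(2) by blast
    qed
    then show "\<exists>c\<ge>1. \<exists>T\<^sub>0. \<forall>z \<tau>. z \<in> ball x \<eta> \<longrightarrow> \<phi> \<tau> z \<in> ball y \<eta> \<longrightarrow> T\<^sub>0 \<le> \<tau> \<longrightarrow>
      (\<exists>z' \<tau>'. \<bar>\<tau>' - (\<tau> + c)\<bar> \<le> \<epsilon> \<and> \<phi> \<tau>' z' = z' \<and>
        (\<forall>s\<in>{0..\<tau>}. dist (\<phi> s z') (\<phi> s z) \<le> 2 * \<epsilon>) \<and> (\<exists>s. dist (\<phi> s z') q < 3 * \<epsilon>))"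
      using p(1) p'(1) by (intro exI[of _ "t + t'"] conjI exI[of _ "max 0 Tmin"]) auto
  qed
qed

end

section \<open>Counting chords by periodic orbits\<close>

context H_flow_speed
begin

text \<open>The second coordinate of the injection \<open>z \<mapsto> (\<gamma>, j)\<close> records the position of the point on its
  orbit \<open>\<gamma>\<close>, up to an error too small for two separated points.\<close>

lemma card_separated_le:
  assumes "finite Os" "0 < \<delta>" "0 \<le> M"
    and sep: "separating \<phi> \<delta> T E"
    and shadow: "\<And>z. z \<in> E \<Longrightarrow> \<exists>z' \<tau>. (range (\<lambda>t. \<phi> t z'), \<tau>) \<in> Os \<and> 0 < \<tau> \<and> \<tau> \<le> M \<and> \<phi> \<tau> z' = z' \<and>
      (\<forall>s\<in>{0..T}. dist (\<phi> s z') (\<phi> s z) \<le> \<delta> / 4)"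
  shows "finite E" "real (card E) \<le> real (card Os) * (M * (4 * b / \<delta>) + 1)"
proof -
  \<comment> \<open>The base point depends on the orbit alone, so positions of different chords on
    the same orbit are comparable.\<close>
  define base where "base \<gamma> = (SOME x. x \<in> fst \<gamma>)" for \<gamma> :: "'a set \<times> real"
  define \<Phi> where "\<Phi> z \<gamma> u \<longleftrightarrow> \<gamma> \<in> Os \<and> 0 \<le> u \<and> u \<le> M \<and>
    (\<forall>s\<in>{0..T}. dist (\<phi> s (\<phi> u (base \<gamma>))) (\<phi> s z) \<le> \<delta> / 4)" for z \<gamma> u
  have "\<exists>\<gamma> u. \<Phi> z \<gamma> u" if z: "z \<in> E" for z
  proof -
    obtain z' \<tau> where z': "(range (\<lambda>t. \<phi> t z'), \<tau>) \<in> Os" "0 < \<tau>" "\<tau> \<le> M" "\<phi> \<tau> z' = z'"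
      "\<forall>s\<in>{0..T}. dist (\<phi> s z') (\<phi> s z) \<le> \<delta> / 4"
      using shadow[OF z] by (elim exE conjE)
    define \<gamma> where "\<gamma> = (range (\<lambda>t. \<phi> t z'), \<tau>)"
    have "base \<gamma> \<in> range (\<lambda>t. \<phi> t z')" unfolding base_def \<gamma>_def fst_conv by (rule someI) blast
    then obtain t where t: "base \<gamma> = \<phi> t z'" by blast
    have "\<phi> (- t) (base \<gamma>) = z'" using t by simp
    moreover have "\<phi> \<tau> (base \<gamma>) = base \<gamma>" unfolding t using z'(4) by (metis add.commute flow_add)
    moreover obtain u k where "0 \<le> u" "u < \<tau>" "- t = u + of_int k * \<tau>"
      using real_mod_period[OF z'(2)] by metis
    ultimately have "\<phi> u (base \<gamma>) = z'" "0 \<le> u" "u \<le> M" using flow_period_multiple z'(3) by auto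
    then have "\<Phi> z \<gamma> u" using z' by (simp add: \<Phi>_def \<gamma>_def)
    then show ?thesis by blast
  qed
  then obtain \<gamma> u where "\<And>z. z \<in> E \<Longrightarrow> \<Phi> z (\<gamma> z) (u z)" by metis
  note \<gamma>u = this[unfolded \<Phi>_def]
  \<comment> \<open>Positions are sorted into cells of length \<open>\<delta> / (4 * b)\<close>. Two
    points in one cell stay less than \<open>\<delta> / 4\<close> apart, and the two shadowing
    errors add at most \<open>\<delta> / 2\<close>, in total less than \<delta>.\<close>
  define a where "a = 4 * b / \<delta>"
  have "a > 0" using speed_pos \<open>0 < \<delta>\<close> by (simp add: a_def)
  define j where "j z = nat \<lfloor>u z * a\<rfloor>" for z
  have j: "real (j z) \<le> u z * a" "u z * a < real (j z) + 1" if "z \<in> E" for z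
  proof -
    have "0 \<le> u z * a" using \<gamma>u[OF that] \<open>a > 0\<close> by simp
    then show "real (j z) \<le> u z * a" "u z * a < real (j z) + 1" unfolding j_def by linarith+
  qed
  let ?f = "\<lambda>z. (\<gamma> z, j z)" and ?B = "Os \<times> {..nat \<lfloor>M * a\<rfloor>}"
  have inj: "inj_on ?f E"
  proof (rule inj_onI, rule ccontr)
    fix y z assume yz: "y \<in> E" "z \<in> E" "?f y = ?f z" "y \<noteq> z"
    then obtain s where s: "s \<in> {0..T}" "\<delta> \<le> dist (\<phi> s y) (\<phi> s z)"
      using sep unfolding separating_def by blast
    have "\<bar>u z * a - u y * a\<bar> < 1" using j[of y] j[of z] yz by auto
    then have "\<bar>u z - u y\<bar> * a < 1" using \<open>a > 0\<close> by (simp add: abs_mult flip: left_diff_distrib)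
    then have "b * \<bar>u z - u y\<bar> < \<delta> / 4" using \<open>0 < \<delta>\<close> by (simp add: a_def field_simps)
    moreover have "dist (\<phi> s (\<phi> (u y) (base (\<gamma> y)))) (\<phi> s (\<phi> (u z) (base (\<gamma> y)))) \<le> b * \<bar>u z - u y\<bar>"
      using dist_flow_flow[of "s + u y" "base (\<gamma> y)" "s + u z"] by (simp add: flow_add)
    moreover have "dist (\<phi> s (\<phi> (u y) (base (\<gamma> y)))) (\<phi> s y) \<le> \<delta> / 4"
      "dist (\<phi> s (\<phi> (u z) (base (\<gamma> y)))) (\<phi> s z) \<le> \<delta> / 4"
      using \<gamma>u[OF yz(1)] \<gamma>u[OF yz(2)] yz(3) s(1) by auto
    ultimately have "dist (\<phi> s y) (\<phi> s z) < \<delta>"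
      using dist_triangle3[of "\<phi> s y" "\<phi> s z" "\<phi> s (\<phi> (u y) (base (\<gamma> y)))"]
        dist_triangle[of "\<phi> s (\<phi> (u y) (base (\<gamma> y)))" "\<phi> s z" "\<phi> s (\<phi> (u z) (base (\<gamma> y)))"] \<open>0 < \<delta>\<close>
      by linarith
    then show False using s(2) by simp
  qed
  have sub: "?f ` E \<subseteq> ?B"
  proof
    fix v assume "v \<in> ?f ` E"
    then obtain z where z: "z \<in> E" "v = (\<gamma> z, j z)" by blast
    have "u z * a \<le> M * a" using \<gamma>u[OF z(1)] \<open>a > 0\<close> by simp
    then have "j z \<le> nat \<lfloor>M * a\<rfloor>" unfolding j_def by (intro nat_mono floor_mono)
    then show "v \<in> ?B" using \<gamma>u[OF z(1)] z(2) by simp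
  qed
  have "finite ?B" using \<open>finite Os\<close> by simp
  then show "finite E" using inj_on_finite[OF inj sub] by blast
  have "card E \<le> card Os * (nat \<lfloor>M * a\<rfloor> + 1)"
    using card_inj_on_le[OF inj sub \<open>finite ?B\<close>] by (simp add: card_cartesian_product)
  then have "real (card E) \<le> real (card Os) * (real (nat \<lfloor>M * a\<rfloor>) + 1)"
    by (metis of_nat_1 of_nat_add of_nat_le_iff of_nat_mult)
  moreover have "0 \<le> M * a" using \<open>0 \<le> M\<close> \<open>a > 0\<close> by simp
  then have "real (nat \<lfloor>M * a\<rfloor>) + 1 \<le> M * a + 1" by linarith
  ultimately show "real (card E) \<le> real (card Os) * (M * (4 * b / \<delta>) + 1)"
    unfolding a_def[symmetric] by (meson mult_left_mono of_nat_0_le_iff order.trans)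
qed

text \<open>If the closed orbit met \<open>K\<close> while following the chord, the chord would be
  in \<open>K'\<close> there, yet outside \<open>shrink K' \<rho>\<close>, hence within \<rho> of
  the frontier of \<open>K'\<close>. That frontier point would lie within \<open>2 * \<rho>\<close>
  of \<open>K\<close>, where everything is interior to \<open>K'\<close>. So \<open>K\<close> can be
  visited only between \<tau> and \<open>\<tau>'\<close>.\<close>

lemma closed_chord_rarely_in:
  assumes away: "\<And>p. p \<in> K \<Longrightarrow> ball p (3 * \<rho>) \<subseteq> K'"
    and z: "\<And>t. t \<in> {0..\<tau>} \<Longrightarrow> \<phi> t z \<notin> shrink K' \<rho>" and "\<rho> > 0" "0 \<le> \<tau>"
    and z': "\<phi> \<tau>' z' = z'" "\<And>t. t \<in> {0..\<tau>} \<Longrightarrow> dist (\<phi> t z') (\<phi> t z) \<le> \<rho>"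
    and "\<phi> s z' \<in> K" and \<tau>': "0 < \<tau>'" "\<tau> \<le> \<tau>'" "\<tau>' - \<tau> < \<alpha> * \<tau>'" and "closed K"
    and window: "T\<^sub>0 \<le> \<tau>'" "\<tau>' \<le> T\<^sub>1"
  shows "(range (\<lambda>t. \<phi> t z'), \<tau>') \<in> orbits_rarely_in \<phi> K \<alpha> T\<^sub>0 T\<^sub>1"
proof -
  have outside: "\<phi> t z' \<notin> K" if t: "t \<in> {0..\<tau>}" for t
  proof
    assume p: "\<phi> t z' \<in> K"
    have near: "dist (\<phi> t z') (\<phi> t z) \<le> \<rho>" using z'(2)[OF t] .
    then have "\<phi> t z \<in> K'" using away[OF p] \<open>\<rho> > 0\<close> by auto
    then obtain q where q: "q \<in> frontier K'" "dist q (\<phi> t z) < \<rho>"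
      using z[OF t] by (auto simp: shrink_def)
    then have "q \<in> ball (\<phi> t z') (3 * \<rho>)"
      using near dist_triangle2[of "\<phi> t z'" q "\<phi> t z"] \<open>\<rho> > 0\<close> by simp
    then have "q \<in> interior K'" using away[OF p] interior_maximal open_ball by blast
    then show False using q(1) by (simp add: frontier_def)
  qed
  have "time_in \<phi> (range (\<lambda>t. \<phi> t z'), \<tau>') K = measure lebesgue {t \<in> {0..\<tau>'}. \<phi> t z' \<in> K}"
    using \<tau>'(1) z'(1) \<open>closed K\<close> by (rule time_in_eq)
  also have "\<dots> \<le> measure lebesgue {\<tau>..\<tau>'}"
  proof (rule measure_mono_fmeasurable)
    show "{t \<in> {0..\<tau>'}. \<phi> t z' \<in> K} \<subseteq> {\<tau>..\<tau>'}" using outside by force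
    have "{t \<in> {0..\<tau>'}. \<phi> t z' \<in> K} = {0..\<tau>'} \<inter> (\<lambda>t. \<phi> t z') -` K" by auto
    moreover have "closed ((\<lambda>t. \<phi> t z') -` K)"
      using \<open>closed K\<close> by (intro closed_vimage continuous_intros)
    ultimately have "closed {t \<in> {0..\<tau>'}. \<phi> t z' \<in> K}" by auto
    then show "{t \<in> {0..\<tau>'}. \<phi> t z' \<in> K} \<in> sets lebesgue" by (simp add: borel_closed)
  qed simp
  also have "\<dots> < \<alpha> * \<tau>'" using \<tau>' by simp
  finally have "time_in \<phi> (range (\<lambda>t. \<phi> t z'), \<tau>') K < \<alpha> * \<tau>'" .
  then show ?thesis
    using \<tau>'(1) z'(1) \<open>\<phi> s z' \<in> K\<close> window
    by (auto simp: orbits_rarely_in_def orbits_meeting_def periodic_orbits_def)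
qed

text \<open>The radius \<eta> precedes the end points, because the supremum over them is taken at
  fixed \<eta>. The closing time \<open>c\<close> and the threshold for \<open>T\<close> may depend
  on them, because the limsup is taken inside that supremum.\<close>

lemma chord_entropy_outside_le:
  assumes "0 < \<sigma>" "0 < C" "0 < \<alpha>" and gurevic: "gurevic_entropy_outside \<sigma> \<phi> K \<alpha> < ereal r"
    and "closed K" "compact K'" and away: "\<And>p. p \<in> K \<Longrightarrow> ball p (3 * \<rho>) \<subseteq> K'" and "\<rho> > 0"
    and q: "q \<in> K'" "ball q \<rho> \<subseteq> K" and "0 < \<delta>"
  obtains \<eta> where "\<eta> > 0" "chord_entropy_outside C \<phi> K' \<delta> \<eta> \<le> ereal r"
proof -
  \<comment> \<open>The bound 1 keeps \<epsilon> below the closing time \<open>c\<close>,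
    \<open>\<delta> / 8\<close> gives shadowing within \<open>\<delta> / 4\<close>, and
    \<open>\<rho> / 3\<close> puts the passage near \<open>q\<close> into \<open>K\<close>.\<close>
  define \<epsilon> where "\<epsilon> = min (min 1 (\<delta> / 8)) (\<rho> / 3)"
  have \<epsilon>: "0 < \<epsilon>" "\<epsilon> \<le> 1" "2 * \<epsilon> \<le> \<delta> / 4" "3 * \<epsilon> \<le> \<rho>"
    using \<open>0 < \<delta>\<close> \<open>\<rho> > 0\<close> by (auto simp: \<epsilon>_def)
  obtain \<eta>' where "\<eta>' > 0" and closing': "\<And>x y q. x \<in> K' \<Longrightarrow> y \<in> K' \<Longrightarrow> q \<in> K' \<Longrightarrow>
    \<exists>c\<ge>1. \<exists>T\<^sub>0. \<forall>z \<tau>. z \<in> ball x \<eta>' \<longrightarrow> \<phi> \<tau> z \<in> ball y \<eta>' \<longrightarrow> T\<^sub>0 \<le> \<tau> \<longrightarrow>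
      (\<exists>z' \<tau>'. \<bar>\<tau>' - (\<tau> + c)\<bar> \<le> \<epsilon> \<and> \<phi> \<tau>' z' = z' \<and>
        (\<forall>s\<in>{0..\<tau>}. dist (\<phi> s z') (\<phi> s z) \<le> 2 * \<epsilon>) \<and> (\<exists>s. dist (\<phi> s z') q < 3 * \<epsilon>))"
    using close_chords[OF \<open>compact K'\<close> \<epsilon>(1)] by blast
  define \<eta> where "\<eta> = min \<eta>' \<rho>"
  have \<eta>: "0 < \<eta>" "\<eta> \<le> \<eta>'" "\<eta> \<le> \<rho>" using \<open>\<eta>' > 0\<close> \<open>\<rho> > 0\<close> by (auto simp: \<eta>_def)
  obtain L\<^sub>0 where L\<^sub>0: "\<And>L. L\<^sub>0 \<le> L \<Longrightarrow>
      \<exists>k. ecard (orbits_rarely_in \<phi> K \<alpha> L (L + \<sigma>)) = enat k \<and> real k \<le> exp (r * L)"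
    using eventually_le_exp_if_Limsup_less[OF gurevic[unfolded gurevic_entropy_outside_def]]
    unfolding eventually_at_top_linorder by blast
  \<comment> \<open>The periods obtained from chords of length \<open>T\<close> to
    \<open>T + C\<close> fill an interval of length \<open>C + 2 * \<epsilon>\<close>, covered by
    \<open>m + 1\<close> windows of length \<sigma>.\<close>
  define m where "m = nat \<lfloor>(C + 2 * \<epsilon>) / \<sigma>\<rfloor>"
  have "Limsup at_top (\<lambda>T. elog (chord_number \<phi> K' x y \<eta> T (T + C) \<delta>) / ereal T) \<le> ereal r"
    if xy: "x \<in> frontier K'" "y \<in> frontier K'" for x y
  proof -
    have "closed K'" using \<open>compact K'\<close> by (rule compact_imp_closed)
    then have "x \<in> K'" "y \<in> K'" using xy frontier_subset_closed by blast+
    then obtain c T\<^sub>0 where "c \<ge> 1" and close: "\<forall>z \<tau>. z \<in> ball x \<eta>' \<longrightarrow> \<phi> \<tau> z \<in> ball y \<eta>' \<longrightarrow> T\<^sub>0 \<le> \<tau> \<longrightarrow>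
      (\<exists>z' \<tau>'. \<bar>\<tau>' - (\<tau> + c)\<bar> \<le> \<epsilon> \<and> \<phi> \<tau>' z' = z' \<and>
        (\<forall>s\<in>{0..\<tau>}. dist (\<phi> s z') (\<phi> s z) \<le> 2 * \<epsilon>) \<and> (\<exists>s. dist (\<phi> s z') q < 3 * \<epsilon>))"
      using closing'[OF \<open>x \<in> K'\<close> \<open>y \<in> K'\<close> q(1)] by (elim exE conjE)
    define d where "d = c + real m * \<sigma>"
    define M where "M T = T + C + c + \<epsilon>" for T
    define p where "p T = (real m + 1) * exp (\<bar>r\<bar> * d) * (M T * (4 * b / \<delta>) + 1)" for T
    have bound: "\<exists>k. chord_number \<phi> K' x y \<eta> T (T + C) \<delta> = enat k \<and> real k \<le> exp (r * T) * p T"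
      if "max (max 1 T\<^sub>0) (max L\<^sub>0 ((c + \<epsilon> + 1) / \<alpha>)) \<le> T" for T
    proof -
      have T: "1 \<le> T" "T\<^sub>0 \<le> T" "L\<^sub>0 \<le> T" "(c + \<epsilon> + 1) / \<alpha> \<le> T" using that by simp_all
      \<comment> \<open>The closed orbit leaves the chord for a time of at most
        \<open>c + \<epsilon>\<close>; from here on this is less than \<alpha> times the
        period.\<close>
      have "c + \<epsilon> + 1 \<le> \<alpha> * T" using T(4) \<open>0 < \<alpha>\<close> by (simp add: field_simps)
      define L where "L i = T + (c - \<epsilon>) + real i * \<sigma>" for i
      have L: "T \<le> L i" "L i \<le> T + d" if "i \<le> m" for i
      proof -
        have "0 \<le> real i * \<sigma>" "real i * \<sigma> \<le> real m * \<sigma>" using that \<open>0 < \<sigma>\<close> by simp_all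
        then show "T \<le> L i" "L i \<le> T + d" using \<open>c \<ge> 1\<close> \<epsilon> by (auto simp: L_def d_def)
      qed
      define Os where "Os = (\<Union>i\<le>m. orbits_rarely_in \<phi> K \<alpha> (L i) (L i + \<sigma>))"
      have Oi: "finite (orbits_rarely_in \<phi> K \<alpha> (L i) (L i + \<sigma>)) \<and>
          real (card (orbits_rarely_in \<phi> K \<alpha> (L i) (L i + \<sigma>))) \<le> exp (r * T) * exp (\<bar>r\<bar> * d)"
        if "i \<le> m" for i
      proof -
        have "r * (L i - T) \<le> \<bar>r\<bar> * (L i - T)" using L[OF that] by (intro mult_right_mono) auto
        also have "\<dots> \<le> \<bar>r\<bar> * d" using L[OF that] by (intro mult_left_mono) auto
        finally have "exp (r * L i) \<le> exp (r * T) * exp (\<bar>r\<bar> * d)"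
          by (simp add: right_diff_distrib flip: exp_add)
        moreover have "L\<^sub>0 \<le> L i" using T(3) L[OF that] by linarith
        ultimately show ?thesis using L\<^sub>0[of "L i"] by (auto simp: ecard_def split: if_splits)
      qed
      then have "finite Os" by (simp add: Os_def)
      have "real (card Os) \<le> (\<Sum>i\<le>m. real (card (orbits_rarely_in \<phi> K \<alpha> (L i) (L i + \<sigma>))))"
        unfolding Os_def using card_UN_le[of "{..m}"] by (simp flip: of_nat_sum)
      also have "\<dots> \<le> (\<Sum>i\<le>m. exp (r * T) * exp (\<bar>r\<bar> * d))" using Oi by (intro sum_mono) simp
      finally have card_Os: "real (card Os) \<le> (real m + 1) * (exp (r * T) * exp (\<bar>r\<bar> * d))"
        by (simp add: add.commute)
      have "0 \<le> M T" using T(1) \<open>c \<ge> 1\<close> \<epsilon>(1) \<open>0 < C\<close> by (simp add: M_def)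
      have "0 \<le> M T * (4 * b / \<delta>) + 1" using \<open>0 \<le> M T\<close> speed_pos \<open>0 < \<delta>\<close> by simp
      have shadow: "\<exists>z' \<tau>'. (range (\<lambda>t. \<phi> t z'), \<tau>') \<in> Os \<and> 0 < \<tau>' \<and> \<tau>' \<le> M T \<and> \<phi> \<tau>' z' = z' \<and>
          (\<forall>s\<in>{0..T}. dist (\<phi> s z') (\<phi> s z) \<le> \<delta> / 4)"
        if z: "z \<in> chords \<phi> K' x y \<eta> T (T + C)" for z
      proof -
        obtain \<tau> where \<tau>: "z \<in> ball x \<eta>" "T \<le> \<tau>" "\<tau> \<le> T + C" "\<phi> \<tau> z \<in> ball y \<eta>"
          "(\<lambda>t. \<phi> t z) ` {0..\<tau>} \<inter> shrink K' \<eta> = {}"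
          using z by (auto simp: chords_def)
        have "shrink K' \<rho> \<subseteq> shrink K' \<eta>"
          unfolding shrink_def by (intro Diff_mono UN_mono subset_ball \<eta>(3)) auto
        then have avoid: "\<phi> t z \<notin> shrink K' \<rho>" if "t \<in> {0..\<tau>}" for t
          using \<tau>(5) imageI[OF that, of "\<lambda>t. \<phi> t z"] by blast
        have "z \<in> ball x \<eta>'" "\<phi> \<tau> z \<in> ball y \<eta>'"
          using subset_ball[OF \<eta>(2)] \<tau>(1,4) by blast+
        moreover have "T\<^sub>0 \<le> \<tau>" using T(2) \<tau>(2) by linarith
        ultimately have "\<exists>z' \<tau>'. \<bar>\<tau>' - (\<tau> + c)\<bar> \<le> \<epsilon> \<and> \<phi> \<tau>' z' = z' \<and>
            (\<forall>s\<in>{0..\<tau>}. dist (\<phi> s z') (\<phi> s z) \<le> 2 * \<epsilon>) \<and> (\<exists>s. dist (\<phi> s z') q < 3 * \<epsilon>)"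
          by (intro close[rule_format])
        then obtain z' \<tau>' s where z': "\<bar>\<tau>' - (\<tau> + c)\<bar> \<le> \<epsilon>" "\<phi> \<tau>' z' = z'"
          "\<forall>s\<in>{0..\<tau>}. dist (\<phi> s z') (\<phi> s z) \<le> 2 * \<epsilon>" "dist (\<phi> s z') q < 3 * \<epsilon>"
          by (elim exE conjE)
        have "\<phi> s z' \<in> ball q \<rho>" using z'(4) \<epsilon>(4) by (simp add: dist_commute)
        then have "\<phi> s z' \<in> K" using q(2) by blast
        have \<tau>': "\<tau> \<le> \<tau>'" "\<tau>' \<le> \<tau> + c + \<epsilon>" "\<tau> + c - \<epsilon> \<le> \<tau>'" using z'(1) \<open>c \<ge> 1\<close> \<epsilon> by linarith+
        have "T \<le> \<tau>'" "0 < \<tau>'" "0 \<le> \<tau>" using \<tau>(2) \<tau>'(1) T by linarith+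
        then have "\<alpha> * T \<le> \<alpha> * \<tau>'" using \<open>0 < \<alpha>\<close> by simp
        then have rare: "\<tau>' - \<tau> < \<alpha> * \<tau>'" using \<tau>'(2) \<open>c + \<epsilon> + 1 \<le> \<alpha> * T\<close> by linarith
        define i where "i = nat \<lfloor>(\<tau>' - (T + (c - \<epsilon>))) / \<sigma>\<rfloor>"
        have "0 \<le> (\<tau>' - (T + (c - \<epsilon>))) / \<sigma>" using \<tau>' \<tau>(2) \<open>0 < \<sigma>\<close> by simp
        then have "real i \<le> (\<tau>' - (T + (c - \<epsilon>))) / \<sigma>" "(\<tau>' - (T + (c - \<epsilon>))) / \<sigma> < real i + 1"
          unfolding i_def by linarith+
        then have window: "L i \<le> \<tau>'" "\<tau>' \<le> L i + \<sigma>"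
          using \<open>0 < \<sigma>\<close> by (simp_all add: L_def field_simps)
        have "(\<tau>' - (T + (c - \<epsilon>))) / \<sigma> \<le> (C + 2 * \<epsilon>) / \<sigma>"
          using \<tau>' \<tau>(3) \<open>0 < \<sigma>\<close> by (intro divide_right_mono) auto
        then have "i \<le> m" unfolding i_def m_def by (intro nat_mono floor_mono)
        have near: "dist (\<phi> t z') (\<phi> t z) \<le> \<rho>" if "t \<in> {0..\<tau>}" for t
          using bspec[OF z'(3) that] \<epsilon> by linarith
        have "(range (\<lambda>t. \<phi> t z'), \<tau>') \<in> orbits_rarely_in \<phi> K \<alpha> (L i) (L i + \<sigma>)"
          by (rule closed_chord_rarely_in[OF away avoid \<open>\<rho> > 0\<close> \<open>0 \<le> \<tau>\<close> z'(2) near \<open>\<phi> s z' \<in> K\<close>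
                \<open>0 < \<tau>'\<close> \<tau>'(1) rare \<open>closed K\<close> window])
        then have "(range (\<lambda>t. \<phi> t z'), \<tau>') \<in> Os" using \<open>i \<le> m\<close> by (auto simp: Os_def)
        moreover have "\<tau>' \<le> M T" using \<tau>'(2) \<tau>(3) by (simp add: M_def)
        moreover have "dist (\<phi> s z') (\<phi> s z) \<le> \<delta> / 4" if "s \<in> {0..T}" for s
          using bspec[OF z'(3), of s] that \<tau>(2) \<epsilon>(3) by simp
        ultimately show ?thesis using \<open>0 < \<tau>'\<close> z'(2) by blast
      qed
      have "ecard E \<le> enat (nat \<lfloor>exp (r * T) * p T\<rfloor>)"
        if E: "E \<subseteq> chords \<phi> K' x y \<eta> T (T + C)" "separating \<phi> \<delta> T E" for E
      proof -
        note card_E = card_separated_le[OF \<open>finite Os\<close> \<open>0 < \<delta>\<close> \<open>0 \<le> M T\<close> E(2) shadow[OF subsetD[OF E(1)]]]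
        have "finite E" by (rule card_E(1))
        have "real (card E) \<le> real (card Os) * (M T * (4 * b / \<delta>) + 1)" by (rule card_E(2))
        also have "\<dots> \<le> (real m + 1) * (exp (r * T) * exp (\<bar>r\<bar> * d)) * (M T * (4 * b / \<delta>) + 1)"
          using card_Os \<open>0 \<le> M T * (4 * b / \<delta>) + 1\<close> by (rule mult_right_mono)
        also have "\<dots> = exp (r * T) * p T" by (simp add: p_def mult_ac)
        finally have "card E \<le> nat \<lfloor>exp (r * T) * p T\<rfloor>" by (rule le_nat_floor)
        then show ?thesis using \<open>finite E\<close> by (simp add: ecard_def)
      qed
      then have "chord_number \<phi> K' x y \<eta> T (T + C) \<delta> \<le> enat (nat \<lfloor>exp (r * T) * p T\<rfloor>)"
        unfolding chord_number_eq[OF \<open>0 < \<delta>\<close>] by (intro SUP_least) blast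
      then obtain k where k: "chord_number \<phi> K' x y \<eta> T (T + C) \<delta> = enat k"
        "k \<le> nat \<lfloor>exp (r * T) * p T\<rfloor>"
        by (cases "chord_number \<phi> K' x y \<eta> T (T + C) \<delta>") auto
      have "0 \<le> exp (r * T) * p T" using \<open>0 \<le> M T * (4 * b / \<delta>) + 1\<close> by (simp add: p_def)
      then have "real k \<le> exp (r * T) * p T" using k(2) by linarith
      then show ?thesis using k(1) by blast
    qed
    show ?thesis
    proof (rule Limsup_elog_le)
      show "\<forall>\<^sub>F T in at_top. \<exists>k. chord_number \<phi> K' x y \<eta> T (T + C) \<delta> = enat k \<and>
          real k \<le> exp (r * T) * p T"
        using eventually_ge_at_top[of "max (max 1 T\<^sub>0) (max L\<^sub>0 ((c + \<epsilon> + 1) / \<alpha>))"]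
        by (rule eventually_mono) (rule bound)
      fix s :: real assume "s > 0"
      define D where "D = (real m + 1) * exp (\<bar>r\<bar> * d)"
      define a where "a = 4 * b / \<delta>"
      have "p T = (D * a) * T + D * ((C + c + \<epsilon>) * a + 1)" for T
        unfolding p_def M_def D_def[symmetric] a_def[symmetric] by (simp add: algebra_simps)
      then show "\<forall>\<^sub>F T in at_top. p T \<le> exp (s * T)"
        using eventually_affine_le_exp[OF \<open>s > 0\<close>] by simp
    qed
  qed
  then have "chord_entropy_outside C \<phi> K' \<delta> \<eta> \<le> ereal r"
    unfolding chord_entropy_outside_def by (intro SUP_least)
  then show thesis using \<eta>(1) that by blast
qed

text \<open>The set \<open>K'\<close> and \<rho> are fixed before \<delta>, since the supremum over
  \<delta> is taken for one compact set; only \<eta> depends on \<delta>.\<close>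

lemma chord_entropy_le:
  assumes "compact K" "interior K \<noteq> {}" "0 < \<sigma>" "0 < C" "0 < \<alpha>"
    and gurevic: "gurevic_entropy_outside \<sigma> \<phi> K \<alpha> < ereal r"
  obtains K' where "compact K'" "interior K' \<noteq> {}"
    "(SUP \<delta>\<in>{0<..}. INF \<eta>\<in>{0<..}. chord_entropy_outside C \<phi> K' \<delta> \<eta>) \<le> ereal r"
proof -
  obtain K' \<rho>\<^sub>1 where K': "compact K'" "\<rho>\<^sub>1 > 0" "\<And>x. x \<in> K \<Longrightarrow> ball x \<rho>\<^sub>1 \<subseteq> K'"
    using compact_neighbourhood[OF \<open>compact K\<close>] by blast
  \<comment> \<open>An interior point is a target that orbits hit even approximately, which makes
    the closed orbits meet \<open>K\<close>.\<close>
  obtain q where "q \<in> interior K" using \<open>interior K \<noteq> {}\<close> by blast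
  then obtain \<rho>\<^sub>2 where \<rho>\<^sub>2: "\<rho>\<^sub>2 > 0" "ball q \<rho>\<^sub>2 \<subseteq> K" by (auto simp: mem_interior)
  define \<rho> where "\<rho> = min (\<rho>\<^sub>1 / 3) \<rho>\<^sub>2"
  have \<rho>: "\<rho> > 0" "3 * \<rho> \<le> \<rho>\<^sub>1" "\<rho> \<le> \<rho>\<^sub>2" using K'(2) \<rho>\<^sub>2(1) by (auto simp: \<rho>_def)
  have away: "ball p (3 * \<rho>) \<subseteq> K'" if "p \<in> K" for p
    using K'(3)[OF that] subset_ball[OF \<rho>(2)] by blast
  have "K \<subseteq> K'" using away \<rho>(1) by (meson centre_in_ball mult_pos_pos subset_iff zero_less_numeral)
  have "(INF \<eta>\<in>{0<..}. chord_entropy_outside C \<phi> K' \<delta> \<eta>) \<le> ereal r" if "\<delta> > 0" for \<delta>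
  proof -
    have "q \<in> K'" "ball q \<rho> \<subseteq> K"
      using \<open>q \<in> interior K\<close> interior_subset \<open>K \<subseteq> K'\<close> subset_ball[OF \<rho>(3)] \<rho>\<^sub>2(2) by blast+
    then obtain \<eta> where "\<eta> > 0" "chord_entropy_outside C \<phi> K' \<delta> \<eta> \<le> ereal r"
      using chord_entropy_outside_le[OF assms(3-5) gurevic compact_imp_closed[OF \<open>compact K\<close>] K'(1) away
          \<rho>(1) _ _ \<open>\<delta> > 0\<close>] by blast
    then show ?thesis by (intro INF_lower2[of \<eta>]) auto
  qed
  then have "(SUP \<delta>\<in>{0<..}. INF \<eta>\<in>{0<..}. chord_entropy_outside C \<phi> K' \<delta> \<eta>) \<le> ereal r"
    by (intro SUP_least) simp
  moreover have "interior K' \<noteq> {}" using interior_mono[OF \<open>K \<subseteq> K'\<close>] \<open>interior K \<noteq> {}\<close> by blast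
  ultimately show thesis using that K'(1) by blast
qed

text \<open>Comparing through real rates strictly above the value for one compact set avoids
  arithmetic with infinite entropies: above \<infinity> there is nothing to check, and -\<infinity>
  admits every real rate.\<close>

lemma gurevic_eq_chord:
  assumes "0 < \<sigma>" "0 < C"
  shows "gurevic_entropy_at_infinity \<sigma> \<phi> = chord_entropy_at_infinity C \<phi>"
proof (rule antisym)
  show "gurevic_entropy_at_infinity \<sigma> \<phi> \<le> chord_entropy_at_infinity C \<phi>"
    unfolding gurevic_entropy_at_infinity_eq chord_entropy_at_infinity_eq
  proof (rule INF_greatest, rule dense_ge)
    fix K :: "'a set" and v
    assume K: "K \<in> {K. compact K \<and> interior K \<noteq> {}}"
      and v: "(SUP \<delta>\<in>{0<..}. INF \<eta>\<in>{0<..}. chord_entropy_outside C \<phi> K \<delta> \<eta>) < v"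
    obtain r' where r': "(SUP \<delta>\<in>{0<..}. INF \<eta>\<in>{0<..}. chord_entropy_outside C \<phi> K \<delta> \<eta>) < ereal r'"
      "ereal r' < v"
      using ereal_dense2[OF v] by (elim exE conjE)
    obtain r where r: "(SUP \<delta>\<in>{0<..}. INF \<eta>\<in>{0<..}. chord_entropy_outside C \<phi> K \<delta> \<eta>) < ereal r"
      "ereal r < ereal r'"
      using ereal_dense2[OF r'(1)] by (elim exE conjE)
    obtain K' where "compact K'" "interior K' \<noteq> {}"
      "(INF \<alpha>\<in>{0<..}. gurevic_entropy_outside \<sigma> \<phi> K' \<alpha>) \<le> ereal r'"
    proof (rule gurevic_entropy_le[OF _ _ assms r(1)])
      show "r < r'" using r(2) by simp
    qed (use K in simp_all)
    then have "(INF K\<in>{K. compact K \<and> interior K \<noteq> {}}. INF \<alpha>\<in>{0<..}. gurevic_entropy_outside \<sigma> \<phi> K \<alpha>)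
        \<le> ereal r'"
      by (intro INF_lower2[of K']) auto
    then show "(INF K\<in>{K. compact K \<and> interior K \<noteq> {}}. INF \<alpha>\<in>{0<..}. gurevic_entropy_outside \<sigma> \<phi> K \<alpha>) \<le> v"
      using r'(2) by (meson less_imp_le order.trans)
  qed
  show "chord_entropy_at_infinity C \<phi> \<le> gurevic_entropy_at_infinity \<sigma> \<phi>"
    unfolding gurevic_entropy_at_infinity_eq chord_entropy_at_infinity_eq
  proof (rule INF_greatest, rule INF_greatest, rule dense_ge)
    fix K :: "'a set" and \<alpha> :: real and v
    assume K: "K \<in> {K. compact K \<and> interior K \<noteq> {}}" and "\<alpha> \<in> {0<..}"
      and v: "gurevic_entropy_outside \<sigma> \<phi> K \<alpha> < v"
    obtain r where r: "gurevic_entropy_outside \<sigma> \<phi> K \<alpha> < ereal r" "ereal r < v"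
      using ereal_dense2[OF v] by (elim exE conjE)
    obtain K' where "compact K'" "interior K' \<noteq> {}"
      "(SUP \<delta>\<in>{0<..}. INF \<eta>\<in>{0<..}. chord_entropy_outside C \<phi> K' \<delta> \<eta>) \<le> ereal r"
      by (rule chord_entropy_le[OF _ _ assms _ r(1)]) (use K \<open>\<alpha> \<in> {0<..}\<close> in simp_all)
    then have "(INF K\<in>{K. compact K \<and> interior K \<noteq> {}}.
        SUP \<delta>\<in>{0<..}. INF \<eta>\<in>{0<..}. chord_entropy_outside C \<phi> K \<delta> \<eta>) \<le> ereal r"
      by (intro INF_lower2[of K']) auto
    then show "(INF K\<in>{K. compact K \<and> interior K \<noteq> {}}.
        SUP \<delta>\<in>{0<..}. INF \<eta>\<in>{0<..}. chord_entropy_outside C \<phi> K \<delta> \<eta>) \<le> v"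
      using r(2) by (meson less_imp_le order.trans)
  qed
qed

end

theorem theorem5p22:
  fixes A :: "('a::metric_space, 'e::euclidean_space) chart set"
    and g :: "('a, 'e) local_metric"
    and \<phi> :: "real \<Rightarrow> 'a \<Rightarrow> 'a"
    and \<sigma> C :: real
  assumes "H_flow A g \<phi>" and "\<sigma> > 0" and "C > 0"
  shows "gurevic_entropy_at_infinity \<sigma> \<phi> = chord_entropy_at_infinity C \<phi>"
proof -
  obtain b where "b > 0" "\<forall>x t. dist x (\<phi> t x) \<le> b * \<bar>t\<bar>"
    using H_flow.ex_speed_bound[OF assms(1)] by blast
  then interpret H_flow_speed A g \<phi> b
    using assms(1) by (simp add: H_flow_speed_def H_flow_speed_axioms_def)
  show ?thesis using assms(2,3) by (rule gurevic_eq_chord)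
qed

end
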